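(* Let $\mathcal S=(a_i)_{i\ge1}$ be an arbitrary infinite sequence of elementary foldings. Then in the folding pattern $P_{\mathcal S}$ the densities of all eight types of unit triangles exist and are equal (each equal to $\frac18$).
   Context: Grid: let $\xi_1=(0,-2\sqrt3)$ and let $\xi_2,\xi_3$ be its counterclockwise rotations by $2\pi/3$ and $4\pi/3$. For $i\in\{1,2,3\}$, $n\in\mathbb Z$ put $\ell_{i,n}=\{x\in\mathbb R^2:(x,\xi_i)=3n+1\}$. The union $\mathcal L$ of all $\ell_{i,n}$ is a triangular grid whose smallest triangles (unit triangles) are regular of side $1$; unit edges are the sides of unit triangles. A unit triangle is positive if its vertex opposite its horizontal side lies above that side, negative otherwise. $O$ is the origin and $T_0$ is the positive unit triangle centered at $O$; $(-2)^kT_0$ is its image under the homothety with center $O$ and ratio $(-2)^k$. Folding patterns: an elementary folding folds a paper regular triangle of side $2a$ along its three midsegments onto its central triangle of side $a$; it is a folding up ($+$) if all three folds go through the upper half-space of $\mathbb R^3$ and a folding down ($-$) if all go through the lower half-space. When unfolded, fold lines of a folding up become valleys and those of a folding down become peaks. For a finite sequence $(a_1,\dots,a_k)$ take the paper triangle $(-2)^kT_0$, perform $a_k$ first (onto $(-2)^{k-1}T_0$), then $a_{k-1}$, …, finally $a_1$ (onto $T_0$), then unfold; valleys are colored red and peaks blue. For an infinite sequence $\mathcal S=(a_i)_{i\ge1}$, $P_{\mathcal S}$ is the red/blue coloring of all unit edges of $\mathcal L$ in which each edge gets its color from the pattern of $(a_1,\dots,a_k)$ for any $k$ with the edge interior to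 $(-2)^kT_0$. Types: a unit triangle's type is given by its orientation (positive or negative) together with its number of red sides ($0,1,2,3$), giving eight types. The density of a type is the limit as $R\to\infty$ of the proportion of unit triangles of that type among all unit triangles contained in the ball of radius $R$ centered at $O$. *)

theory Defs
  imports "HOL-Analysis.Analysis"
begin

type_synonym point = "real^2"

definition rot :: "real \<Rightarrow> point \<Rightarrow> point" where
  "rot t x = vector [cos t * x$1 - sin t * x$2, sin t * x$1 + cos t * x$2]"

definition xi :: "nat \<Rightarrow> point" where
  "xi i = rot (2 * pi / 3 * (real i - 1)) (vector [0, - 2 * sqrt 3])"

definition grid_line :: "nat \<Rightarrow> int \<Rightarrow> point set" where
  "grid_line i n = {x. x \<bullet> xi i = 3 * of_int n + 1}"

definition grid :: "point set" where
  "grid = (\<Union>i\<in>{1,2,3}. \<Union>n. grid_line i n)"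

definition unit_triangles :: "point set set" where
  "unit_triangles = {convex hull {a, b, c} | a b c.
     dist a b = 1 \<and> dist b c = 1 \<and> dist c a = 1 \<and>
     closed_segment a b \<subseteq> grid \<and> closed_segment b c \<subseteq> grid \<and> closed_segment c a \<subseteq> grid}"

text \<open>The unit edges are the sets \<open>e\<close> with \<open>e edge_of T\<close> for some unit triangle \<open>T\<close>.\<close>

datatype orientation = Positive | Negative

definition orientation :: "point set \<Rightarrow> orientation" where
  "orientation T =
     (if \<exists>a b c. T = convex hull {a, b, c} \<and> a \<noteq> b \<and> a$2 = b$2 \<and> c$2 > a$2
      then Positive else Negative)"

definition T0 :: "point set" where
  "T0 = convex hull {vector [- 1/2, - sqrt 3 / 6], vector [1/2, - sqrt 3 / 6], vector [0, sqrt 3 / 3]}"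

definition paper :: "nat \<Rightarrow> point set" where
  "paper k = (\<lambda>x. (-2) ^ k *\<^sub>R x) ` T0"

datatype folding = Up | Down

datatype color = Red | Blue

text \<open>
  An elementary folding of \<open>paper (Suc k)\<close> onto its central triangle \<open>paper k\<close>.
  Since \<open>T0 = {x. \<forall>i\<in>{1,2,3}. x \<bullet> xi i \<le> 1}\<close>, the midsegments of \<open>paper (Suc k)\<close>, which are the
  sides of \<open>paper k\<close>, lie on the lines \<open>x \<bullet> xi i = (-2)^k\<close>, and each cuts off one corner triangle
  (a flap). Two flaps meet only in an endpoint of their midsegments, which both reflections fix, so
  the order of the cases in \<open>fold_map\<close> is irrelevant.
\<close>

definition midsegment :: "nat \<Rightarrow> nat \<Rightarrow> point set" where
  "midsegment i k = {x \<in> paper (Suc k). x \<bullet> xi i = (-2) ^ k}"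

definition flap :: "nat \<Rightarrow> nat \<Rightarrow> point set" where
  "flap i k = {x \<in> paper (Suc k). x \<bullet> xi i / (-2) ^ k \<ge> 1}"

definition reflect_mid :: "nat \<Rightarrow> nat \<Rightarrow> point \<Rightarrow> point" where
  "reflect_mid i k x = x - (2 * (x \<bullet> xi i - (-2) ^ k) / (xi i \<bullet> xi i)) *\<^sub>R xi i"

definition fold_map :: "nat \<Rightarrow> point \<Rightarrow> point" where
  "fold_map k x =
     (if x \<in> flap 1 k then reflect_mid 1 k x
      else if x \<in> flap 2 k then reflect_mid 2 k x
      else if x \<in> flap 3 k then reflect_mid 3 k x
      else x)"

text \<open>
  The color, on the original upper side of the paper, of a crease made in a layer of the folded
  paper; \<open>up\<close> says whether the original upper side of this layer faces up at that moment. In a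
  layer that has been turned over, a folding up makes a peak and a folding down a valley.
\<close>

fun crease_color :: "folding \<Rightarrow> bool \<Rightarrow> color" where
  "crease_color Up up = (if up then Red else Blue)"
| "crease_color Down up = (if up then Blue else Red)"

text \<open>
  \<open>crease S k up e\<close>: the color that an edge \<open>e\<close> of the grid, currently lying in \<open>paper k\<close> in a layer
  with facing \<open>up\<close>, receives from the foldings \<open>S k, S (k - 1), \<dots>, S 1\<close>, performed in this order;
  \<open>None\<close> if no fold goes along it. An edge that lies in a flap but not on the midsegment is carried
  along by the fold, and its layer is turned over.
\<close>

fun crease :: "(nat \<Rightarrow> folding) \<Rightarrow> nat \<Rightarrow> bool \<Rightarrow> point set \<Rightarrow> color option" where
  "crease S 0 up e = None"
| "crease S (Suc k) up e =
     (if \<exists>i\<in>{1,2,3}. e \<subseteq> midsegment i k then Some (crease_color (S (Suc k)) up)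
      else if \<exists>i\<in>{1,2,3}. e \<subseteq> flap i k then crease S k (\<not> up) (fold_map k ` e)
      else crease S k up (fold_map k ` e))"

definition edge_inside :: "point set \<Rightarrow> nat \<Rightarrow> bool" where
  "edge_inside e k \<longleftrightarrow> rel_interior e \<subseteq> interior (paper k)"

text \<open>
  The coloring \<open>P\<^sub>S\<close>. The terms of the sequence are \<open>S 1, S 2, \<dots>\<close>; the value \<open>S 0\<close> is never used.
\<close>

definition pattern :: "(nat \<Rightarrow> folding) \<Rightarrow> point set \<Rightarrow> color" where
  "pattern S e = (THE c. \<exists>k. edge_inside e k \<and> crease S k True e = Some c)"

definition red_sides :: "(nat \<Rightarrow> folding) \<Rightarrow> point set \<Rightarrow> nat" where
  "red_sides S T = card {e. e edge_of T \<and> pattern S e = Red}"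

definition triangle_type :: "(nat \<Rightarrow> folding) \<Rightarrow> point set \<Rightarrow> orientation \<times> nat" where
  "triangle_type S T = (orientation T, red_sides S T)"

definition unit_triangles_in_ball :: "real \<Rightarrow> point set set" where
  "unit_triangles_in_ball R = {T \<in> unit_triangles. T \<subseteq> ball 0 R}"

definition has_density :: "(nat \<Rightarrow> folding) \<Rightarrow> orientation \<times> nat \<Rightarrow> real \<Rightarrow> bool" where
  "has_density S ty d \<longleftrightarrow>
     ((\<lambda>R. real (card {T \<in> unit_triangles_in_ball R. triangle_type S T = ty}) /
            real (card (unit_triangles_in_ball R))) \<longlongrightarrow> d) at_top"

end

theory Submission
  imports Defs
begin

text \<open>
  In the coordinates \<open>x \<bullet> xi i\<close> the grid, the paper triangles and the folds are given by congruences
  modulo 3 and linear inequalities, and no fold line separates two neighbouring grid vertices. Hence,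
  by induction along the foldings, the pattern of \<open>(a\<^sub>1, a\<^sub>2, \<dots>)\<close> arises from that of
  \<open>(a\<^sub>2, a\<^sub>3, \<dots>)\<close> by substitution: blow up a unit triangle by the factor \<open>- 2\<close> and cut it
  along its midsegments. The halves of a side inherit its color, and the three midsegments all get
  the color of \<open>a\<^sub>1\<close>, swapped for negative triangles.

  If \<open>p\<^sub>0, \<dots>, p\<^sub>3\<close> and \<open>q\<^sub>0, \<dots>, q\<^sub>3\<close> count the positive and negative triangles by their red sides,
  the substitution for \<open>a\<^sub>1\<close> a folding up turns \<open>p\<close> into \<open>(3q\<^sub>0 + q\<^sub>1, 2q\<^sub>1 + 2q\<^sub>2, q\<^sub>2 + 3q\<^sub>3, \<Sum>p)\<close>
  and \<open>q\<close> into \<open>(\<Sum>q, 3p\<^sub>0 + p\<^sub>1, 2p\<^sub>1 + 2p\<^sub>2, p\<^sub>2 + 3p\<^sub>3)\<close>. The total number of triangles grows by the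
  factor 4, but the deviation from the uniform distribution, measured in a weighted
  \<open>\<ell>\<^sup>1\<close>-norm, by at most 3. The ball of radius \<open>R\<close> is, up to \<open>O(R)\<close> triangles, the
  substitution of the ball of radius \<open>R / 2\<close>; so after \<open>n\<close> steps the relative deviation is
  \<open>O((3/4)\<^sup>n + 1/R)\<close> for each fixed \<open>n\<close>.
\<close>

subsection \<open>Coordinates and the folding map\<close>

text \<open>Keeps the index \<open>1\<close> from turning into \<open>Suc 0\<close>, so that facts
  about \<open>xi 1\<close> still match after simplification.\<close>

declare One_nat_def [simp del]

lemma xi_1: "xi 1 = vector [0, - 2 * sqrt 3]"
  by (simp add: xi_def rot_def)

lemma xi_2: "xi 2 = vector [3, sqrt 3]"
  by (simp add: xi_def rot_def cos_120 sin_120)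

lemma xi_3: "xi 3 = vector [- 3, sqrt 3]"
proof -
  have *: "2 * pi / 3 * 2 = pi / 3 + pi" by simp
  have "cos (2 * pi / 3 * 2) = - 1 / 2" "sin (2 * pi / 3 * 2) = - sqrt 3 / 2"
    unfolding * cos_periodic_pi sin_periodic_pi by (simp_all add: cos_60 sin_60)
  then have "cos (4 * pi / 3) = - 1 / 2" "sin (4 * pi / 3) = - sqrt 3 / 2"
    by simp_all
  then show ?thesis
    by (simp add: xi_def rot_def)
qed

lemmas xi_simps = xi_1 xi_2 xi_3

lemma inner_point: "(x::point) \<bullet> y = x$1 * y$1 + x$2 * y$2"
  by (simp add: inner_vec_def sum_2)

text \<open>The three vectors have length \<open>2 * sqrt 3\<close> and mutual angles of 120
  degrees, whose cosine is -1/2.\<close>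

lemma xi_inner_xi:
  assumes "i \<in> {1,2,3}" "j \<in> {1,2,3}"
  shows "xi i \<bullet> xi j = (if i = j then 12 else - 6)"
  using assms by (auto simp: xi_simps inner_point)

lemma xi_sum: "xi 1 + xi 2 + xi 3 = 0"
  by (simp add: xi_simps vec_eq_iff forall_2)

lemma coord_sum: "x \<bullet> xi 1 + x \<bullet> xi 2 + x \<bullet> xi 3 = 0"
  by (metis inner_add_right inner_zero_right xi_sum)

text \<open>The three vectors form a tight frame: the sum of
  \<open>(x \<bullet> xi i) *\<^sub>R xi i\<close> is \<open>18 *\<^sub>R x\<close>. Distances can
  thus be read off from the redundant coordinates, and these determine the point.\<close>

lemma norm_coords: "(norm x)\<^sup>2 = ((x \<bullet> xi 1)\<^sup>2 + (x \<bullet> xi 2)\<^sup>2 + (x \<bullet> xi 3)\<^sup>2) / 18"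
  unfolding power2_norm_eq_inner
  by (simp add: xi_simps inner_point power2_eq_square algebra_simps)

lemma coords_eqI:
  assumes "\<And>i. i \<in> {1,2,3} \<Longrightarrow> x \<bullet> xi i = y \<bullet> xi i"
  shows "x = y"
proof -
  have "(norm (x - y))\<^sup>2 = 0"
    unfolding norm_coords using assms by (simp add: inner_diff_left)
  then show ?thesis by simp
qed

section \<open>The base triangle, its enlargements and the folds in coordinates\<close>

definition T0_vertex :: "nat \<Rightarrow> point" where
  "T0_vertex j = (- 1 / 6) *\<^sub>R xi j"

lemma T0_vertex_coord:
  assumes "i \<in> {1,2,3}" "j \<in> {1,2,3}"
  shows "T0_vertex j \<bullet> xi i = (if i = j then - 2 else 1)"
  using xi_inner_xi[OF assms(2,1)] by (auto simp: T0_vertex_def)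

lemma T0_eq: "T0 = convex hull {T0_vertex 1, T0_vertex 2, T0_vertex 3}"
proof -
  have "T0_vertex 1 = vector [0, sqrt 3 / 3]" "T0_vertex 2 = vector [- 1/2, - sqrt 3 / 6]"
    "T0_vertex 3 = vector [1/2, - sqrt 3 / 6]"
    by (simp_all add: T0_vertex_def xi_simps vec_eq_iff forall_2)
  then show ?thesis
    unfolding T0_def by (simp add: insert_commute)
qed

lemma mem_T0: "x \<in> T0 \<longleftrightarrow> (\<forall>i\<in>{1,2,3}. x \<bullet> xi i \<le> 1)"
proof
  assume "x \<in> T0"
  then obtain a b c where "0 \<le> a" "0 \<le> b" "0 \<le> c" "a + b + c = 1"
    and "x = a *\<^sub>R T0_vertex 1 + b *\<^sub>R T0_vertex 2 + c *\<^sub>R T0_vertex 3"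
    unfolding T0_eq convex_hull_3 by blast
  then show "\<forall>i\<in>{1,2,3}. x \<bullet> xi i \<le> 1"
    by (auto simp: inner_add_left T0_vertex_coord)
next
  assume le: "\<forall>i\<in>{1,2,3}. x \<bullet> xi i \<le> 1"
  \<comment> \<open>The barycentric coordinate at vertex \<open>i\<close>: it vanishes on the
    opposite side, where the coordinate is 1, and the divisor 3 is the drop from there to the value
    -2 at the vertex.\<close>
  define l where "l i = (1 - x \<bullet> xi i) / 3" for i
  have "x = l 1 *\<^sub>R T0_vertex 1 + l 2 *\<^sub>R T0_vertex 2 + l 3 *\<^sub>R T0_vertex 3"
    by (rule coords_eqI) (use coord_sum[of x] in \<open>auto simp: inner_add_left T0_vertex_coord l_def field_simps\<close>)
  moreover have "l 1 + l 2 + l 3 = 1"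
    using coord_sum[of x] by (simp add: l_def field_simps)
  ultimately show "x \<in> T0"
    using le unfolding T0_eq convex_hull_3 mem_Collect_eq
    by (intro exI[of _ "l 1"] exI[of _ "l 2"] exI[of _ "l 3"]) (auto simp: l_def)
qed

text \<open>Rescaling by \<open>(-2) ^ k\<close> puts the sides of \<open>paper k\<close> on the lines \<open>level_coord k i x = 1\<close> and those of
  \<open>paper (Suc k)\<close> on the lines \<open>level_coord k i x = - 2\<close>, independently of \<open>k\<close>.\<close>

definition level_coord :: "nat \<Rightarrow> nat \<Rightarrow> point \<Rightarrow> real" where
  "level_coord k i x = x \<bullet> xi i / (-2) ^ k"

lemma level_coord_sum: "level_coord k 1 x + level_coord k 2 x + level_coord k 3 x = 0"
  using coord_sum[of x] by (simp add: level_coord_def flip: add_divide_distrib)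

lemma level_coord_add: "level_coord k i (x + y) = level_coord k i x + level_coord k i y"
  by (simp add: level_coord_def inner_add_left add_divide_distrib)

lemma level_coord_scale: "level_coord k i (c *\<^sub>R x) = c * level_coord k i x"
  by (simp add: level_coord_def)

lemma level_coord_Suc: "level_coord k i x = - 2 * level_coord (Suc k) i x"
  by (simp add: level_coord_def)

lemma mem_paper: "x \<in> paper k \<longleftrightarrow> (\<forall>i\<in>{1,2,3}. level_coord k i x \<le> 1)"
proof -
  have "x \<in> paper k \<longleftrightarrow> (1 / (-2) ^ k) *\<^sub>R x \<in> T0"
    unfolding paper_def by (auto simp: image_iff intro!: bexI[of _ "(1 / (-2) ^ k) *\<^sub>R x"])
  then show ?thesis
    by (simp add: mem_T0 level_coord_def)
qed

lemma mem_paper_Suc: "x \<in> paper (Suc k) \<longleftrightarrow> (\<forall>i\<in>{1,2,3}. level_coord k i x \<ge> -2)"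
  unfolding mem_paper by (simp add: level_coord_Suc[of k])

lemma paper_mono_Suc: "paper k \<subseteq> paper (Suc k)"
proof
  fix x assume "x \<in> paper k"
  then show "x \<in> paper (Suc k)"
    using level_coord_sum[of k x] unfolding mem_paper_Suc by (auto simp: mem_paper)
qed

lemma mem_flap: "x \<in> flap i k \<longleftrightarrow> (\<forall>j\<in>{1,2,3}. level_coord k j x \<ge> -2) \<and> level_coord k i x \<ge> 1"
  unfolding flap_def mem_Collect_eq mem_paper_Suc by (simp add: level_coord_def)

lemma mem_midsegment: "x \<in> midsegment i k \<longleftrightarrow> (\<forall>j\<in>{1,2,3}. level_coord k j x \<ge> -2) \<and> level_coord k i x = 1"
  unfolding midsegment_def mem_Collect_eq mem_paper_Suc by (auto simp: level_coord_def)

text \<open>The reflection subtracts a multiple of \<open>xi i\<close> chosen to send coordinate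
  \<open>i\<close> to its mirror value. Since \<open>xi i \<bullet> xi j\<close> is minus half of
  \<open>xi i \<bullet> xi i\<close>, every other coordinate moves by half as much in the opposite
  direction.\<close>

lemma level_coord_reflect:
  assumes "i \<in> {1,2,3}" "j \<in> {1,2,3}"
  shows "level_coord k j (reflect_mid i k x) = (if i = j then 2 - level_coord k i x else level_coord k j x + level_coord k i x - 1)"
  using xi_inner_xi[OF assms(1) assms(1)] xi_inner_xi[OF assms]
  by (auto simp: level_coord_def reflect_mid_def inner_diff_left field_simps)

lemma level_coord_eqI:
  assumes "\<And>i. i \<in> {1,2,3} \<Longrightarrow> level_coord k i x = level_coord k i y"
  shows "x = y"
  by (rule coords_eqI) (use assms in \<open>simp add: level_coord_def\<close>)

text \<open>Lying in two flaps forces the coordinates 1, 1, -2, because they are at least 1, 1, -2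
  and add up to 0. Such a point is on both fold lines and fixed by both reflections.\<close>

lemma fold_map_flap:
  assumes i: "i \<in> {1,2,3}" and x: "x \<in> flap i k"
  shows "fold_map k x = reflect_mid i k x"
proof -
  have *: "reflect_mid j k x = reflect_mid i k x" if "j \<in> {1,2,3}" "x \<in> flap j k" for j
    by (rule level_coord_eqI[of k])
      (use i x that level_coord_sum[of k x] in \<open>auto simp: level_coord_reflect mem_flap\<close>)
  show ?thesis
    unfolding fold_map_def using i x *[of 1] *[of 2] *[of 3] by (simp split: if_split) blast
qed

lemma fold_map_paper:
  assumes "x \<in> paper k"
  shows "fold_map k x = x"
proof -
  have "reflect_mid i k x = x" if "i \<in> {1,2,3}" "x \<in> flap i k" for i
    by (rule level_coord_eqI[of k]) (use that assms in \<open>auto simp: level_coord_reflect mem_flap mem_paper\<close>)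
  then show ?thesis
    by (auto simp: fold_map_def)
qed

lemma reflect_in_paper:
  assumes "i \<in> {1,2,3}" "x \<in> flap i k"
  shows "reflect_mid i k x \<in> paper k"
  using assms level_coord_sum[of k x] by (auto simp: level_coord_reflect mem_flap mem_paper)

lemma reflect_segment:
  "reflect_mid i k ` closed_segment a b = closed_segment (reflect_mid i k a) (reflect_mid i k b)"
proof -
  have "reflect_mid i k ((1 - t) *\<^sub>R a + t *\<^sub>R b)
      = (1 - t) *\<^sub>R reflect_mid i k a + t *\<^sub>R reflect_mid i k b" for t
    by (simp add: reflect_mid_def algebra_simps diff_divide_distrib add_divide_distrib
        flip: scaleR_add_left)
  then show ?thesis
    unfolding closed_segment_image_interval image_image by simp
qed

subsection \<open>Creases of grid edges\<close>

lemma minus2_power_mod3: "\<exists>m::int. (-2::real) ^ k = 3 * of_int m + 1"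
proof (induction k)
  case 0
  show ?case by (rule exI[of _ 0]) simp
next
  case (Suc k)
  then obtain m :: int where "(-2::real) ^ k = 3 * of_int m + 1" by blast
  then show ?case by (intro exI[of _ "- 2 * m - 1"]) simp
qed

lemma coord_reflect:
  assumes "i \<in> {1,2,3}" "j \<in> {1,2,3}"
  shows "reflect_mid i k x \<bullet> xi j
    = (if i = j then 2 * (-2) ^ k - x \<bullet> xi i else x \<bullet> xi j + x \<bullet> xi i - (-2) ^ k)"
  using xi_inner_xi[OF assms(1) assms(1)] xi_inner_xi[OF assms]
  by (auto simp: reflect_mid_def inner_diff_left field_simps)

section \<open>Clusters of neighbouring grid vertices\<close>

definition grid_vertex :: "point \<Rightarrow> bool" where
  "grid_vertex x \<longleftrightarrow> (\<forall>i\<in>{1,2,3}. \<exists>n::int. x \<bullet> xi i = 3 * of_int n + 1)"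

text \<open>Since \<open>(-2) ^ k\<close> is congruent to 1 modulo 3, like the coordinates of the grid vertices, a fold line
  cannot strictly separate two vertices whose coordinates differ by at most 3.\<close>

definition cluster :: "point set \<Rightarrow> bool" where
  "cluster F \<longleftrightarrow> (\<forall>a\<in>F. grid_vertex a) \<and>
     (\<forall>a\<in>F. \<forall>b\<in>F. \<forall>i\<in>{1,2,3}. \<bar>a \<bullet> xi i - b \<bullet> xi i\<bar> \<le> 3)"

text \<open>Measured in steps of 3 from the fold line, the two vertices sit at integers that differ
  by at most 1, so these cannot have strictly opposite signs. The product form absorbs the sign of
  \<open>(-2) ^ k\<close>.\<close>

lemma cluster_same_side:
  assumes F: "cluster F" and "a \<in> F" "b \<in> F" and i: "i \<in> {1,2,3}"
  shows "0 \<le> (level_coord k i a - 1) * (level_coord k i b - 1)"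
proof -
  define L :: real where "L = (-2) ^ k"
  have "L \<noteq> 0" by (simp add: L_def)
  obtain m :: int where m: "L = 3 * of_int m + 1"
    using minus2_power_mod3 unfolding L_def by blast
  obtain p q :: int where p: "a \<bullet> xi i = 3 * of_int p + 1" and q: "b \<bullet> xi i = 3 * of_int q + 1"
    using assms unfolding cluster_def grid_vertex_def by meson
  have "\<bar>a \<bullet> xi i - b \<bullet> xi i\<bar> \<le> 3"
    using assms unfolding cluster_def by blast
  then have "\<bar>real_of_int (p - q)\<bar> \<le> 1"
    unfolding p q by simp
  then have "\<bar>p - q\<bar> \<le> 1" by linarith
  then have "0 \<le> (p - m) * (q - m)"
    unfolding zero_le_mult_iff by linarith
  then have "0 \<le> real_of_int ((p - m) * (q - m))"
    by linarith
  then have "0 \<le> (9 / L\<^sup>2) * real_of_int ((p - m) * (q - m))"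
    by (intro mult_nonneg_nonneg) auto
  also have "\<dots> = (3 * real_of_int (p - m) / L) * (3 * real_of_int (q - m) / L)"
    by (simp add: power2_eq_square del: of_int_diff)
  also have "3 * real_of_int (p - m) / L = level_coord k i a - 1"
    using \<open>L \<noteq> 0\<close> unfolding level_coord_def p L_def[symmetric] by (simp add: field_simps m)
  also have "3 * real_of_int (q - m) / L = level_coord k i b - 1"
    using \<open>L \<noteq> 0\<close> unfolding level_coord_def q L_def[symmetric] by (simp add: field_simps m)
  finally show ?thesis .
qed

lemma cluster_gt_imp_ge:
  assumes "cluster F" "a \<in> F" "b \<in> F" "i \<in> {1,2,3}" "level_coord k i a > 1"
  shows "level_coord k i b \<ge> 1"
  using cluster_same_side[OF assms(1-4), of k] assms(5) by (auto simp: zero_le_mult_iff)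

lemma cluster_sum_2:
  assumes "cluster F" "a \<in> F" "b \<in> F" "i \<in> {1,2,3}" "level_coord k i a + level_coord k i b = 2"
  shows "level_coord k i a = 1" "level_coord k i b = 1"
  using cluster_same_side[OF assms(1-4), of k] assms(5) by (auto simp: zero_le_mult_iff)

text \<open>As the coordinates add up to 0, a reflected coordinate is, up to a constant, minus an
  old one. Hence differences are only permuted and negated, and all constants involved respect the
  congruence modulo 3.\<close>

lemma cluster_reflect:
  assumes F: "cluster F" and i: "i \<in> {1,2,3}"
  shows "cluster (reflect_mid i k ` F)"
proof -
  obtain m :: int where m: "(-2::real) ^ k = 3 * of_int m + 1"
    using minus2_power_mod3 by blast
  have "\<exists>n::int. reflect_mid i k a \<bullet> xi j = 3 * of_int n + 1" if a: "a \<in> F" and j: "j \<in> {1,2,3}" for a j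
  proof -
    obtain p :: int where p: "a \<bullet> xi i = 3 * of_int p + 1"
      using F a i unfolding cluster_def grid_vertex_def by blast
    obtain q :: int where q: "a \<bullet> xi j = 3 * of_int q + 1"
      using F a j unfolding cluster_def grid_vertex_def by blast
    show ?thesis
      using coord_reflect[OF i j, of k a] unfolding p q m
      by (intro exI[of _ "if i = j then 2 * m - p else p + q - m"]) auto
  qed
  moreover have "\<bar>reflect_mid i k a \<bullet> xi j - reflect_mid i k b \<bullet> xi j\<bar> \<le> 3"
    if "a \<in> F" "b \<in> F" "j \<in> {1,2,3}" for a b j
  proof -
    have "\<forall>l\<in>{1,2,3}. \<bar>a \<bullet> xi l - b \<bullet> xi l\<bar> \<le> 3"
      using F that unfolding cluster_def by blast
    then show ?thesis
      using coord_reflect[OF i that(3), of k a] coord_reflect[OF i that(3), of k b]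
        coord_sum[of a] coord_sum[of b] i that(3) by auto
  qed
  ultimately show ?thesis
    unfolding cluster_def grid_vertex_def by blast
qed

text \<open>The case distinction of every induction along the foldings: a vertex strictly beyond a
  fold line keeps the whole cluster on or beyond that line.\<close>

lemma cluster_pieces:
  assumes F: "cluster F" and P: "F \<subseteq> paper (Suc k)"
  shows "(\<exists>i\<in>{1,2,3}. F \<subseteq> flap i k) \<or> F \<subseteq> paper k"
proof (cases "F \<subseteq> paper k")
  case False
  then obtain a i where ai: "a \<in> F" "i \<in> {1,2,3}" "level_coord k i a > 1"
    unfolding subset_iff mem_paper by (meson not_le)
  then have "\<forall>b\<in>F. level_coord k i b \<ge> 1"
    using cluster_gt_imp_ge[OF F] by blast
  then show ?thesis
    using P ai unfolding subset_iff mem_paper_Suc mem_flap by blast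
qed simp

section \<open>One folding step applied to a segment\<close>

lemma convex_paper: "convex (paper k)"
  unfolding paper_def T0_def by (intro convex_scaling convex_convex_hull)

lemma convex_flap: "convex (flap i k)"
proof -
  have "flap i k = paper (Suc k) \<inter> {x. inner ((1 / (-2) ^ k) *\<^sub>R xi i) x \<ge> 1}"
    by (auto simp: flap_def inner_commute)
  then show ?thesis
    by (simp only: convex_Int convex_paper convex_halfspace_ge)
qed

lemma convex_midsegment: "convex (midsegment i k)"
proof -
  have "midsegment i k = paper (Suc k) \<inter> {x. inner (xi i) x = (-2) ^ k}"
    by (auto simp: midsegment_def inner_commute)
  then show ?thesis
    by (simp only: convex_Int convex_paper convex_hyperplane)
qed

lemma segment_subset_iff:
  assumes "convex C"
  shows "closed_segment a b \<subseteq> C \<longleftrightarrow> a \<in> C \<and> b \<in> C"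
  using closed_segment_subset[OF _ _ assms] ends_in_segment by blast

lemma midsegment_subset_flap: "midsegment i k \<subseteq> flap i k"
  by (auto simp: mem_midsegment mem_flap)

lemma crease_midsegment:
  assumes "i \<in> {1,2,3}" "a \<in> midsegment i k" "b \<in> midsegment i k"
  shows "crease S (Suc k) up (closed_segment a b) = Some (crease_color (S (Suc k)) up)"
proof -
  have "\<exists>i\<in>{1,2,3}. closed_segment a b \<subseteq> midsegment i k"
    using assms segment_subset_iff[OF convex_midsegment] by blast
  then show ?thesis by simp
qed

lemma crease_flap:
  assumes "i \<in> {1,2,3}" "a \<in> flap i k" "b \<in> flap i k"
    and "\<And>j. j \<in> {1,2,3} \<Longrightarrow> a \<in> midsegment j k \<Longrightarrow> b \<notin> midsegment j k"
  shows "crease S (Suc k) up (closed_segment a b)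
    = crease S k (\<not> up) (closed_segment (reflect_mid i k a) (reflect_mid i k b))"
proof -
  have 1: "\<not> (\<exists>i\<in>{1,2,3}. closed_segment a b \<subseteq> midsegment i k)"
    using assms(4) segment_subset_iff[OF convex_midsegment] by blast
  have sub: "closed_segment a b \<subseteq> flap i k"
    using assms segment_subset_iff[OF convex_flap] by blast
  then have 2: "\<exists>i\<in>{1,2,3}. closed_segment a b \<subseteq> flap i k"
    using assms(1) by blast
  have "fold_map k ` closed_segment a b = reflect_mid i k ` closed_segment a b"
    using sub assms(1) by (intro image_cong refl fold_map_flap) auto
  then show ?thesis
    unfolding crease.simps if_not_P[OF 1] if_P[OF 2] reflect_segment by simp
qed

lemma crease_center:
  assumes "a \<in> paper k" "b \<in> paper k"
    and "\<And>j. j \<in> {1,2,3} \<Longrightarrow> a \<in> flap j k \<Longrightarrow> b \<notin> flap j k"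
  shows "crease S (Suc k) up (closed_segment a b) = crease S k up (closed_segment a b)"
proof -
  have 2: "\<not> (\<exists>i\<in>{1,2,3}. closed_segment a b \<subseteq> flap i k)"
    using assms(3) segment_subset_iff[OF convex_flap] by blast
  then have 1: "\<not> (\<exists>i\<in>{1,2,3}. closed_segment a b \<subseteq> midsegment i k)"
    using midsegment_subset_flap by blast
  have "closed_segment a b \<subseteq> paper k"
    using assms segment_subset_iff[OF convex_paper] by blast
  then have "fold_map k ` closed_segment a b = closed_segment a b"
    using fold_map_paper by (force simp: image_iff)
  then show ?thesis
    unfolding crease.simps if_not_P[OF 1] if_not_P[OF 2] by simp
qed

definition inner_edge :: "nat \<Rightarrow> point \<Rightarrow> point \<Rightarrow> bool" where
  "inner_edge k a b \<longleftrightarrow> a \<in> paper k \<and> b \<in> paper k \<and>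
     (\<forall>i\<in>{1,2,3}. \<not> (level_coord k i a = 1 \<and> level_coord k i b = 1))"

text \<open>The lines carrying the sides of \<open>paper (Suc k)\<close> meet \<open>paper k\<close>
  only in its vertices. Two endpoints on such a line would coincide with one vertex and so share a
  side of \<open>paper k\<close>.\<close>

lemma inner_edge_Suc:
  assumes "inner_edge k a b"
  shows "inner_edge (Suc k) a b"
proof -
  have "level_coord (Suc k) i a \<noteq> 1 \<or> level_coord (Suc k) i b \<noteq> 1" if "i \<in> {1,2,3}" for i
  proof (rule ccontr)
    assume "\<not> ?thesis"
    then have "level_coord k i a = -2" "level_coord k i b = -2"
      by (simp_all add: level_coord_Suc[of k])
    then show False
      using that assms level_coord_sum[of k a] level_coord_sum[of k b] by (auto simp: inner_edge_def mem_paper)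
  qed
  then show ?thesis
    using assms paper_mono_Suc unfolding inner_edge_def by blast
qed

text \<open>A flap meets \<open>paper k\<close> only along a side, so the additional first fold
  neither creases nor moves an inner edge. This makes the color independent of the starting
  size.\<close>

lemma crease_inner_Suc:
  assumes "inner_edge k a b"
  shows "crease S (Suc k) up (closed_segment a b) = crease S k up (closed_segment a b)"
  using assms by (intro crease_center) (force simp: inner_edge_def mem_flap mem_paper)+

lemma crease_inner_mono:
  assumes "inner_edge k a b" "k \<le> l"
  shows "inner_edge l a b \<and> crease S l up (closed_segment a b) = crease S k up (closed_segment a b)"
  using assms(2)
proof (induction l rule: dec_induct)
  case base
  then show ?case using assms(1) by simp
next
  case (step l)
  then show ?case
    using inner_edge_Suc crease_inner_Suc by metis
qed

lemma grid_vertex_T0: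
  assumes "grid_vertex x" "x \<in> T0" "i \<in> {1,2,3}"
  shows "x \<bullet> xi i = 1 \<or> x \<bullet> xi i = - 2"
proof -
  obtain n :: "nat \<Rightarrow> int" where n: "\<forall>i\<in>{1,2,3}. x \<bullet> xi i = 3 * of_int (n i) + 1"
    using assms(1) unfolding grid_vertex_def by metis
  have "\<forall>i\<in>{1,2,3}. n i \<le> 0"
    using n assms(2) unfolding mem_T0 by auto
  moreover have "real_of_int (n 1 + n 2 + n 3) = - 1"
    using n coord_sum[of x] by simp
  then have "n 1 + n 2 + n 3 = - 1" by linarith
  ultimately have "n i = 0 \<or> n i = - 1"
    using assms(3) by auto
  then show ?thesis
    using n assms(3) by auto
qed

lemma paper_0: "paper 0 = T0"
  by (simp add: paper_def)

text \<open>Some fold goes along every inner edge. Otherwise the folds would carry it, always as an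
  inner edge, down to \<open>T0\<close>, which has no inner grid edges.\<close>

lemma crease_inner_Some:
  assumes "cluster {a, b}" "inner_edge k a b"
  shows "crease S k up (closed_segment a b) \<noteq> None"
  using assms
proof (induction k arbitrary: a b up)
  case 0
  then have "\<forall>i\<in>{1,2,3}. a \<bullet> xi i = 1 \<or> a \<bullet> xi i = - 2" "\<forall>i\<in>{1,2,3}. b \<bullet> xi i = 1 \<or> b \<bullet> xi i = - 2"
    using grid_vertex_T0 by (auto simp: cluster_def inner_edge_def paper_0)
  \<comment> \<open>Both points are vertices of \<open>T0\<close>, with coordinates 1, 1, -2 in some
    order, so some coordinate equals 1 at both of them.\<close>
  then have False
    using 0 coord_sum[of a] coord_sum[of b] by (auto simp: inner_edge_def level_coord_def)
  then show ?case ..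
next
  case (Suc k)
  have pap: "{a, b} \<subseteq> paper (Suc k)"
    and side: "\<forall>i\<in>{1,2,3}. \<not> (level_coord k i a = - 2 \<and> level_coord k i b = - 2)"
    using Suc.prems unfolding inner_edge_def by (auto simp: level_coord_Suc[of k])
  consider (mid) i where "i \<in> {1,2,3}" "a \<in> midsegment i k" "b \<in> midsegment i k"
    | (flap) i where "i \<in> {1,2,3}" "a \<in> flap i k" "b \<in> flap i k"
        "\<forall>j\<in>{1,2,3}. \<not> (a \<in> midsegment j k \<and> b \<in> midsegment j k)"
    | (center) "a \<in> paper k" "b \<in> paper k" "\<forall>j\<in>{1,2,3}. \<not> (a \<in> flap j k \<and> b \<in> flap j k)"
    using cluster_pieces[OF Suc.prems(1) pap] by blast
  then show ?case
  proof cases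
    case mid
    then show ?thesis by (simp add: crease_midsegment del: crease.simps)
  next
    case flap
    let ?a = "reflect_mid i k a" and ?b = "reflect_mid i k b"
    have nmid: "\<forall>j\<in>{1,2,3}. \<not> (level_coord k j a = 1 \<and> level_coord k j b = 1)"
      using flap by (auto simp: mem_midsegment mem_flap)
    have "cluster {?a, ?b}"
      using cluster_reflect[OF Suc.prems(1) flap(1)] by simp
    \<comment> \<open>The reflected edge could lie along a side of \<open>paper k\<close> only if
      the original lay along the fold line (\<open>i = j\<close>) or along the side of
      \<open>paper (Suc k)\<close> with the third index (\<open>i \<noteq> j\<close>). Both are
      excluded.\<close>
    moreover have "\<not> (level_coord k j ?a = 1 \<and> level_coord k j ?b = 1)" if j: "j \<in> {1,2,3}" for j
    proof (cases "i = j")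
      case True
      then show ?thesis
        using nmid j by (auto simp: level_coord_reflect[OF j j])
    next
      case False
      define l where "l = 6 - i - j"
      have l: "l \<in> {1,2,3}" and sum: "level_coord k i x + level_coord k j x + level_coord k l x = 0" for x
        using flap(1) j False level_coord_sum[of k x] by (auto simp: l_def simp flip: One_nat_def)
      have "\<not> (level_coord k l a = - 2 \<and> level_coord k l b = - 2)"
        using side l by blast
      then show ?thesis
        using sum[of a] sum[of b] False by (auto simp: level_coord_reflect[OF flap(1) j])
    qed
    then have "inner_edge k ?a ?b"
      unfolding inner_edge_def using reflect_in_paper[OF flap(1)] flap(2,3) by blast
    ultimately show ?thesis
      using Suc.IH crease_flap[OF flap(1-3)] flap(4) by metis
  next
    case center
    then have "inner_edge k a b"
      using pap unfolding inner_edge_def insert_subset mem_paper_Suc by (auto simp: mem_flap)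
    then show ?thesis
      using Suc.IH[OF Suc.prems(1)] center crease_center by metis
  qed
qed

section \<open>Creases of the enlarged and subdivided triangle\<close>

lemma level_coord_double: "level_coord (Suc k) i (- 2 *\<^sub>R x) = level_coord k i x"
  by (simp add: level_coord_def)

text \<open>The point \<open>- x - y\<close> is \<open>- 2\<close> times the midpoint of
  \<open>x\<close> and \<open>y\<close>; at the next level its coordinates are therefore
  averages.\<close>

lemma level_coord_neg_add: "level_coord (Suc k) i (- x - y) = (level_coord k i x + level_coord k i y) / 2"
  by (simp add: level_coord_def inner_diff_left field_simps)

lemma reflect_double:
  assumes "i \<in> {1,2,3}"
  shows "reflect_mid i (Suc k) (- 2 *\<^sub>R x) = - 2 *\<^sub>R reflect_mid i k x"
  by (rule level_coord_eqI[of "Suc k"]) (use assms in \<open>simp only: level_coord_double level_coord_reflect\<close>)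

lemma reflect_neg_add:
  assumes "i \<in> {1,2,3}"
  shows "reflect_mid i (Suc k) (- x - y) = - reflect_mid i k x - reflect_mid i k y"
  by (rule level_coord_eqI[of "Suc k"]) (use assms in \<open>auto simp: level_coord_neg_add level_coord_reflect add_divide_distrib diff_divide_distrib\<close>)

lemma mem_double:
  "- 2 *\<^sub>R x \<in> flap i (Suc k) \<longleftrightarrow> x \<in> flap i k"
  "- 2 *\<^sub>R x \<in> midsegment i (Suc k) \<longleftrightarrow> x \<in> midsegment i k"
  "- 2 *\<^sub>R x \<in> paper (Suc k) \<longleftrightarrow> x \<in> paper k"
  by (simp_all only: mem_flap mem_midsegment mem_paper level_coord_double)

lemma half_mem:
  assumes "convex C" "\<And>x. - 2 *\<^sub>R x \<in> C' \<longleftrightarrow> x \<in> C" "x \<in> C" "y \<in> C"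
  shows "- x - y \<in> C'"
proof -
  have "(1/2) *\<^sub>R x + (1/2) *\<^sub>R y \<in> C"
    using assms by (intro convexD) auto
  moreover have "- x - y = - 2 *\<^sub>R ((1/2) *\<^sub>R x + (1/2) *\<^sub>R y)"
    by (simp add: scaleR_right_distrib)
  ultimately show ?thesis
    using assms(2) by metis
qed

lemmas half_in_flap = half_mem[OF convex_flap mem_double(1)]
lemmas half_in_midsegment = half_mem[OF convex_midsegment mem_double(2)]
lemmas half_in_paper = half_mem[OF convex_paper mem_double(3)]

text \<open>The folds \<open>S (Suc k), \<dots>, S 2\<close> treat the enlarged segment as the folds
  of the shifted sequence treat the original one, and both half-sides stay with the whole side at
  every step. By symmetry in \<open>a\<close> and \<open>b\<close> one half suffices.\<close>

lemma crease_half: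
  assumes "cluster {a, b}" "a \<in> paper k" "b \<in> paper k"
    and "crease (\<lambda>n. S (Suc n)) k up (closed_segment a b) = Some c"
  shows "crease S (Suc k) up (closed_segment (- 2 *\<^sub>R a) (- a - b)) = Some c"
  using assms
proof (induction k arbitrary: a b up)
  case 0
  then show ?case by simp
next
  case (Suc k)
  have cl: "cluster {a, b}" by fact
  have pap: "{a, b} \<subseteq> paper (Suc k)"
    using Suc.prems by blast
  let ?p = "- 2 *\<^sub>R a" and ?q = "- a - b"
  consider (mid) i where "i \<in> {1,2,3}" "a \<in> midsegment i k" "b \<in> midsegment i k"
    | (flap) i where "i \<in> {1,2,3}" "a \<in> flap i k" "b \<in> flap i k"
        "\<forall>j\<in>{1,2,3}. \<not> (a \<in> midsegment j k \<and> b \<in> midsegment j k)"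
    | (center) "a \<in> paper k" "b \<in> paper k" "\<forall>j\<in>{1,2,3}. \<not> (a \<in> flap j k \<and> b \<in> flap j k)"
    using cluster_pieces[OF cl pap] by blast
  then show ?case
  proof cases
    case mid
    have "?p \<in> midsegment i (Suc k)" "?q \<in> midsegment i (Suc k)"
      using mid mem_double(2) half_in_midsegment by blast+
    then show ?thesis
      using Suc.prems(4) crease_midsegment[OF mid(1)] crease_midsegment[OF mid] by metis
  next
    case flap
    let ?a = "reflect_mid i k a" and ?b = "reflect_mid i k b"
    have in_flap: "?p \<in> flap i (Suc k)" "?q \<in> flap i (Suc k)"
      using flap mem_double(1) half_in_flap by blast+
    have nmid: "?q \<notin> midsegment j (Suc k)" if "j \<in> {1,2,3}" "?p \<in> midsegment j (Suc k)" for j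
    proof
      assume "?q \<in> midsegment j (Suc k)"
      then have "level_coord k j a = 1" "level_coord k j b = 1"
        using that unfolding mem_double by (auto simp: mem_midsegment level_coord_neg_add)
      then show False
        using flap that(1) by (auto simp: mem_midsegment mem_flap)
    qed
    have "crease S (Suc (Suc k)) up (closed_segment ?p ?q)
      = crease S (Suc k) (\<not> up) (closed_segment (- 2 *\<^sub>R ?a) (- ?a - ?b))"
      using crease_flap[OF flap(1) in_flap nmid] unfolding reflect_double[OF flap(1)] reflect_neg_add[OF flap(1)] .
    moreover have "crease (\<lambda>n. S (Suc n)) k (\<not> up) (closed_segment ?a ?b) = Some c"
      using Suc.prems(4) crease_flap[OF flap(1-3)] flap(4) by metis
    moreover have "cluster {?a, ?b}"
      using cluster_reflect[OF cl flap(1)] by simp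
    ultimately show ?thesis
      using Suc.IH reflect_in_paper[OF flap(1)] flap by metis
  next
    case center
    have "?q \<notin> flap j (Suc k)" if "j \<in> {1,2,3}" "?p \<in> flap j (Suc k)" for j
    proof
      assume "?q \<in> flap j (Suc k)"
      then have "level_coord k j b = 1"
        using that center unfolding mem_double by (auto simp: mem_flap mem_paper level_coord_neg_add)
      then show False
        using center that pap unfolding mem_double insert_subset mem_paper_Suc by (auto simp: mem_flap)
    qed
    then have "crease S (Suc (Suc k)) up (closed_segment ?p ?q) = crease S (Suc k) up (closed_segment ?p ?q)"
      using center mem_double(3) half_in_paper by (intro crease_center) blast+
    moreover have "crease (\<lambda>n. S (Suc n)) k up (closed_segment a b) = Some c"
      using Suc.prems(4) crease_center[OF center(1,2)] center(3) by metis
    ultimately show ?thesis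
      using Suc.IH[OF cl center(1,2)] by metis
  qed
qed

text \<open>The congruence modulo 9 says that the centroid has coordinates congruent to
  \<open>1 - s\<close> modulo 3, which identifies the orientation \<open>s\<close>. Each reflection
  flips both \<open>s\<close> and \<open>up\<close>, so \<open>up = (s = 1)\<close> is invariant.
  The triangle finally lands on \<open>T0\<close>, and then the last fold \<open>S 1\<close> creases
  along its midsegments.\<close>

lemma crease_central:
  assumes "cluster {a, b, c}" "{a, b, c} \<subseteq> paper k" "s = 1 \<or> s = - 1"
    and "\<And>i. i \<in> {1,2,3} \<Longrightarrow> \<exists>n::int. (a + b + c) \<bullet> xi i = 9 * of_int n + 3 * (1 - s)"
  shows "crease S (Suc k) up (closed_segment (- a - b) (- a - c))
    = Some (crease_color (S 1) (up = (s = 1)))"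
  using assms
proof (induction k arbitrary: a b c up s)
  case 0
  have T: "x \<bullet> xi i = 1 \<or> x \<bullet> xi i = - 2" if "x \<in> {a, b, c}" "i \<in> {1,2,3}" for x i
    using 0 that by (intro grid_vertex_T0) (auto simp: cluster_def paper_0)
  have sum: "a \<bullet> xi i + b \<bullet> xi i + c \<bullet> xi i = (if s = 1 then 0 else - 3)" if i: "i \<in> {1,2,3}" for i
  proof -
    obtain n :: int where "a \<bullet> xi i + b \<bullet> xi i + c \<bullet> xi i = 9 * of_int n + 3 * (1 - s)"
      using 0(4)[OF i] by (auto simp: inner_add_left)
    \<comment> \<open>Here \<open>t\<close> is 1 minus the number of vertices with coordinate -2. In
      the range from -2 to 1 its residue modulo 3 determines it.\<close>
    moreover obtain t :: int where t: "a \<bullet> xi i + b \<bullet> xi i + c \<bullet> xi i = 3 * of_int t" "t \<in> {-2..1}"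
    proof
      let ?f = "\<lambda>x. if x \<bullet> xi i = 1 then 0 else 1 :: int"
      show "a \<bullet> xi i + b \<bullet> xi i + c \<bullet> xi i = 3 * of_int (1 - ?f a - ?f b - ?f c)"
        "1 - ?f a - ?f b - ?f c \<in> {-2..1}"
        using T[OF _ i, of a] T[OF _ i, of b] T[OF _ i, of c] by auto
    qed
    ultimately have "of_int t = real_of_int (3 * n + (if s = 1 then 0 else 2))"
      using \<open>s = 1 \<or> s = - 1\<close> by auto
    then have "t = 3 * n + (if s = 1 then 0 else 2)"
      by (simp only: of_int_eq_iff)
    then have "t = (if s = 1 then 0 else - 1)"
      using t(2) unfolding atLeastAtMost_iff by (cases "s = 1") (simp; presburger)+
    then show ?thesis
      using t(1) by simp
  qed
  \<comment> \<open>For \<open>s = - 1\<close> the three coordinate sums would add up to -9,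
    although the coordinates of every point add up to 0.\<close>
  have "s = 1"
    using sum[of 1] sum[of 2] sum[of 3] coord_sum[of a] coord_sum[of b] coord_sum[of c]
    by (auto split: if_splits)
  have neg: "- a - b = c" "- a - c = b"
    by (rule coords_eqI, use sum \<open>s = 1\<close> in \<open>force simp: inner_diff_left\<close>)+
  have "\<exists>i\<in>{1,2,3}. a \<bullet> xi i = - 2"
    using T[of a 1] T[of a 2] T[of a 3] coord_sum[of a] by auto
  then obtain i where i: "i \<in> {1,2,3}" "a \<bullet> xi i = - 2" ..
  then have "b \<bullet> xi i = 1" "c \<bullet> xi i = 1"
    using sum[OF i(1)] T[OF _ i(1), of b] T[OF _ i(1), of c] \<open>s = 1\<close> by auto
  then have "b \<in> midsegment i 0" "c \<in> midsegment i 0"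
    using 0(2) paper_mono_Suc by (auto simp: midsegment_def)
  then show ?case
    using crease_midsegment[OF i(1)] \<open>s = 1\<close> unfolding neg by (simp del: crease.simps add: One_nat_def)
next
  case (Suc k)
  have cl: "cluster {a, b, c}" and pap: "{a, b, c} \<subseteq> paper (Suc k)" by fact+
  let ?p = "- a - b" and ?q = "- a - c"
  define L :: real where "L = (-2) ^ k"
  obtain m :: int where m: "L = 3 * of_int m + 1"
    using minus2_power_mod3 unfolding L_def by blast
  \<comment> \<open>If both midpoints were on the fold line, all three vertices would be, by
    \<open>cluster_sum_2\<close>. Their coordinate sum \<open>3 * L\<close> is 3 modulo 9, whereas
    the hypothesis allows only 0 or 6.\<close>
  have nmid: "?q \<notin> midsegment j (Suc k)" if j: "j \<in> {1,2,3}" and p: "?p \<in> midsegment j (Suc k)" for j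
  proof
    assume q: "?q \<in> midsegment j (Suc k)"
    have "level_coord k j a + level_coord k j b = 2" "level_coord k j a + level_coord k j c = 2"
      using p q by (auto simp: mem_midsegment level_coord_neg_add)
    then have "level_coord k j a = 1" "level_coord k j b = 1" "level_coord k j c = 1"
      using cluster_sum_2[OF cl _ _ j] by blast+
    then have "(a + b + c) \<bullet> xi j = 3 * L"
      by (simp add: level_coord_def inner_add_left L_def)
    moreover obtain n :: int where "(a + b + c) \<bullet> xi j = 9 * of_int n + 3 * (1 - s)"
      using Suc.prems(4)[OF j] by blast
    ultimately have "of_int (3 * m + 1) = real_of_int (3 * n + (if s = 1 then 0 else 2))"
      using \<open>s = 1 \<or> s = - 1\<close> by (auto simp: m)
    then have "3 * m + 1 = 3 * n + (if s = 1 then 0 else 2)"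
      by (simp only: of_int_eq_iff)
    then show False
      by (auto split: if_splits) presburger+
  qed
  consider (flap) i where "i \<in> {1,2,3}" "{a, b, c} \<subseteq> flap i k"
    | (center) "{a, b, c} \<subseteq> paper k"
    using cluster_pieces[OF cl pap] by blast
  then show ?case
  proof cases
    case flap
    have i: "i \<in> {1,2,3}" by fact
    let ?a = "reflect_mid i k a" and ?b = "reflect_mid i k b" and ?c = "reflect_mid i k c"
    have in_flap: "?p \<in> flap i (Suc k)" "?q \<in> flap i (Suc k)"
      using flap half_in_flap by blast+
    have "crease S (Suc (Suc k)) up (closed_segment ?p ?q)
      = crease S (Suc k) (\<not> up) (closed_segment (- ?a - ?b) (- ?a - ?c))"
      using crease_flap[OF i in_flap nmid] unfolding reflect_neg_add[OF i] .
    also have "\<dots> = Some (crease_color (S 1) ((\<not> up) = (- s = 1)))"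
    proof (rule Suc.IH)
      show "cluster {?a, ?b, ?c}"
        using cluster_reflect[OF cl i] by simp
      show "{?a, ?b, ?c} \<subseteq> paper k"
        using flap reflect_in_paper[OF i] by blast
      show "- s = 1 \<or> - s = - 1"
        using Suc.prems(3) by auto
      fix j :: nat assume j: "j \<in> {1,2,3}"
      obtain p q :: int where p: "(a + b + c) \<bullet> xi i = 9 * of_int p + 3 * (1 - s)"
        and q: "(a + b + c) \<bullet> xi j = 9 * of_int q + 3 * (1 - s)"
        using Suc.prems(4) i j by blast
      have "(?a + ?b + ?c) \<bullet> xi j = (if i = j then 6 * L - (a + b + c) \<bullet> xi i
          else (a + b + c) \<bullet> xi j + (a + b + c) \<bullet> xi i - 3 * L)"
        by (simp add: inner_add_left coord_reflect[OF i j] L_def)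
      then show "\<exists>n::int. (?a + ?b + ?c) \<bullet> xi j = 9 * of_int n + 3 * (1 - - s)"
        \<comment> \<open>Off the diagonal the quotient is \<open>p + q - m - s\<close>; the case
          distinction writes the real number \<open>s\<close> as an integer.\<close>
        unfolding p q m using Suc.prems(3)
        by (intro exI[of _ "if i = j then 2 * m - p
             else if s = 1 then p + q - m - 1 else p + q - m + 1"]) auto
    qed
    also have "((\<not> up) = (- s = 1)) = (up = (s = 1))"
      using Suc.prems(3) by auto
    finally show ?thesis .
  next
    case center
    have "?q \<notin> flap j (Suc k)" if j: "j \<in> {1,2,3}" and p: "?p \<in> flap j (Suc k)" for j
    proof
      assume q: "?q \<in> flap j (Suc k)"
      have "level_coord k j a \<le> 1" "level_coord k j b \<le> 1" "level_coord k j c \<le> 1"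
        using center j by (auto simp: mem_paper)
      then have "?p \<in> midsegment j (Suc k)" "?q \<in> midsegment j (Suc k)"
        using p q by (auto simp: mem_midsegment mem_flap level_coord_neg_add)
      then show False
        using nmid[OF j] by blast
    qed
    then have "crease S (Suc (Suc k)) up (closed_segment ?p ?q) = crease S (Suc k) up (closed_segment ?p ?q)"
      using center half_in_paper[of a k b] half_in_paper[of a k c] by (intro crease_center) simp_all
    then show ?thesis
      using Suc.IH[OF cl center Suc.prems(3,4)] by metis
  qed
qed

subsection \<open>The pattern on grid edges\<close>

lemma interior_paper: "interior (paper k) = {x. \<forall>i\<in>{1,2,3}. level_coord k i x < 1}"
proof
  have nz: "xi i \<noteq> 0" if "i \<in> {1,2,3}" for i
    using xi_inner_xi[OF that that] by auto
  have eq: "level_coord k i x = inner ((1 / (-2) ^ k) *\<^sub>R xi i) x" for i x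
    by (simp add: level_coord_def inner_commute)
  have "x \<in> interior {x. level_coord k i x \<le> 1}" if "x \<in> interior (paper k)" "i \<in> {1,2,3}" for x i
    by (rule subsetD[OF interior_mono that(1)]) (use that(2) in \<open>auto simp: mem_paper\<close>)
  moreover have "interior {x. level_coord k i x \<le> 1} = {x. level_coord k i x < 1}" if "i \<in> {1,2,3}" for i
    unfolding eq by (rule interior_halfspace_le) (use nz[OF that] in simp)
  ultimately show "interior (paper k) \<subseteq> {x. \<forall>i\<in>{1,2,3}. level_coord k i x < 1}"
    by blast
  have "{x. \<forall>i\<in>{1,2,3}. level_coord k i x < 1} = {x. level_coord k 1 x < 1} \<inter> {x. level_coord k 2 x < 1} \<inter> {x. level_coord k 3 x < 1}"
    by auto
  then have "open {x. \<forall>i\<in>{1,2,3}. level_coord k i x < 1}"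
    unfolding eq by (simp only: open_Int open_halfspace_lt)
  then show "{x. \<forall>i\<in>{1,2,3}. level_coord k i x < 1} \<subseteq> interior (paper k)"
    by (rule interior_maximal[rotated]) (auto simp: mem_paper)
qed

lemma closed_paper: "closed (paper k)"
  unfolding paper_def T0_def
  by (intro closed_scaling compact_imp_closed compact_convex_hull) auto

text \<open>One direction passes to the closure for the endpoints and uses the midpoint to exclude
  edges along a side. In the other, an interior point of the edge is a proper average, hence
  strictly below 1 when one endpoint is.\<close>

lemma edge_inside_iff:
  assumes "a \<noteq> b"
  shows "edge_inside (closed_segment a b) k \<longleftrightarrow> inner_edge k a b"
proof
  assume "edge_inside (closed_segment a b) k"
  then have sub: "open_segment a b \<subseteq> interior (paper k)"
    using assms by (simp add: edge_inside_def rel_interior_closed_segment)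
  then have "closure (open_segment a b) \<subseteq> paper k"
    by (meson closed_paper closure_minimal interior_subset order_trans)
  then have "closed_segment a b \<subseteq> paper k"
    using assms by simp
  moreover have "midpoint a b \<in> interior (paper k)"
    using sub assms by auto
  then have "level_coord k i (midpoint a b) < 1" if "i \<in> {1,2,3}" for i
    using that unfolding interior_paper by blast
  then have "(level_coord k i a + level_coord k i b) / 2 < 1" if "i \<in> {1,2,3}" for i
    using that by (simp add: midpoint_def level_coord_scale level_coord_add)
  ultimately show "inner_edge k a b"
    unfolding inner_edge_def by fastforce
next
  assume in_e: "inner_edge k a b"
  have "x \<in> interior (paper k)" if x: "x \<in> open_segment a b" for x
  proof -
    obtain t where t: "0 < t" "t < 1" "x = (1 - t) *\<^sub>R a + t *\<^sub>R b"
      using x unfolding in_segment by blast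
    have "level_coord k i x < 1" if i: "i \<in> {1,2,3}" for i
    proof -
      have le: "level_coord k i a \<le> 1" "level_coord k i b \<le> 1" and "level_coord k i a < 1 \<or> level_coord k i b < 1"
        using in_e i unfolding inner_edge_def mem_paper by force+
      then have "0 < (1 - t) * (1 - level_coord k i a) + t * (1 - level_coord k i b)"
        using t by (metis add_nonneg_pos add_pos_nonneg diff_gt_0_iff_gt diff_ge_0_iff_ge less_imp_le
            mult_nonneg_nonneg mult_pos_pos)
      then show ?thesis
        unfolding t(3) level_coord_add level_coord_scale by (simp add: algebra_simps)
    qed
    then show ?thesis
      unfolding interior_paper by blast
  qed
  then show "edge_inside (closed_segment a b) k"
    using assms by (auto simp: edge_inside_def rel_interior_closed_segment)
qed

text \<open>Two admissible sizes are compared at their maximum, where stability gives both the same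
  crease. This is what makes the \<open>THE\<close> in \<open>pattern\<close> well defined.\<close>

lemma pattern_eqI:
  assumes "a \<noteq> b" "inner_edge k a b" "crease S k True (closed_segment a b) = Some c"
  shows "pattern S (closed_segment a b) = c"
  unfolding pattern_def edge_inside_iff[OF assms(1)]
proof (rule the_equality)
  show "\<exists>k. inner_edge k a b \<and> crease S k True (closed_segment a b) = Some c"
    using assms by blast
next
  fix d assume "\<exists>k. inner_edge k a b \<and> crease S k True (closed_segment a b) = Some d"
  then obtain l where "inner_edge l a b" "crease S l True (closed_segment a b) = Some d"
    by blast
  then show "d = c"
    using assms crease_inner_mono[of l a b "max k l"] crease_inner_mono[of k a b "max k l"]
    by (metis max.cobounded1 max.cobounded2 option.inject)
qed

text \<open>Provides one size at which the parent segments and their enlargements are all inner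
  edges.\<close>

lemma eventually_strictly_inside:
  assumes "finite F"
  shows "\<exists>k. \<forall>x\<in>F. \<forall>i\<in>{1,2,3}. level_coord k i x < 1"
proof -
  have "eventually (\<lambda>k. level_coord k i x < 1) sequentially" for i x
  proof -
    have "(\<lambda>k. (x \<bullet> xi i) * (1 / (-2)) ^ k) \<longlonglongrightarrow> (x \<bullet> xi i) * 0"
      by (intro tendsto_mult_left LIMSEQ_power_zero) simp
    then have "(\<lambda>k. level_coord k i x) \<longlonglongrightarrow> 0"
      by (simp only: level_coord_def power_one_over times_divide_eq_right mult_1_right mult_zero_right)
    then show ?thesis
      by (rule order_tendstoD) simp
  qed
  then have "eventually (\<lambda>k. \<forall>x\<in>F. \<forall>i\<in>{1,2,3}. level_coord k i x < 1) sequentially"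
    using assms by (intro eventually_ball_finite ballI) auto
  then show ?thesis
    by (auto simp: eventually_sequentially)
qed

lemma pattern_half:
  assumes cl: "cluster {a, b}" and ab: "a \<noteq> b"
  shows "pattern S (closed_segment (- 2 *\<^sub>R a) (- a - b))
    = pattern (\<lambda>n. S (Suc n)) (closed_segment a b)"
proof -
  obtain k where k: "\<forall>x\<in>{a,b}. \<forall>i\<in>{1,2,3}. level_coord k i x < 1"
    using eventually_strictly_inside[of "{a, b}"] by auto
  then have e: "inner_edge k a b"
    by (force simp: inner_edge_def mem_paper)
  then obtain c where c: "crease (\<lambda>n. S (Suc n)) k True (closed_segment a b) = Some c"
    using crease_inner_Some[OF cl] by blast
  have "crease S (Suc k) True (closed_segment (- 2 *\<^sub>R a) (- a - b)) = Some c"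
    using crease_half[OF cl _ _ c] e by (auto simp: inner_edge_def)
  moreover have "inner_edge (Suc k) (- 2 *\<^sub>R a) (- a - b)"
  proof -
    have "level_coord (Suc k) i (- 2 *\<^sub>R a) < 1" "level_coord (Suc k) i (- a - b) < 1" if "i \<in> {1,2,3}" for i
      unfolding level_coord_double level_coord_neg_add using k that by auto
    then show ?thesis
      unfolding inner_edge_def mem_paper by fastforce
  qed
  moreover have "- 2 *\<^sub>R a \<noteq> - a - b"
    using ab by (simp add: scaleR_2)
  ultimately show ?thesis
    using pattern_eqI[OF ab e c] pattern_eqI by metis
qed

lemma pattern_central:
  assumes cl: "cluster {a, b, c}" and bc: "b \<noteq> c" and s: "s = 1 \<or> s = - 1"
    and "\<And>i. i \<in> {1,2,3} \<Longrightarrow> \<exists>n::int. (a + b + c) \<bullet> xi i = 9 * of_int n + 3 * (1 - s)"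
  shows "pattern S (closed_segment (- a - b) (- a - c)) = crease_color (S 1) (s = 1)"
proof -
  obtain k where k: "\<forall>x\<in>{a,b,c}. \<forall>i\<in>{1,2,3}. level_coord k i x < 1"
    using eventually_strictly_inside[of "{a, b, c}"] by auto
  then have "{a, b, c} \<subseteq> paper k"
    by (force simp: mem_paper)
  then have "crease S (Suc k) True (closed_segment (- a - b) (- a - c)) = Some (crease_color (S 1) (s = 1))"
    using crease_central[OF cl _ s assms(4), where k = k and up = True] by simp
  moreover have "inner_edge (Suc k) (- a - b) (- a - c)"
  proof -
    have "level_coord (Suc k) i (- a - b) < 1" "level_coord (Suc k) i (- a - c) < 1" if "i \<in> {1,2,3}" for i
      unfolding level_coord_neg_add using k that by auto
    then show ?thesis
      unfolding inner_edge_def mem_paper by fastforce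
  qed
  moreover have "- a - b \<noteq> - a - c"
    using bc by simp
  ultimately show ?thesis
    using pattern_eqI by metis
qed

subsection \<open>Unit triangles indexed by centre and orientation\<close>

text \<open>A pair \<open>(p, s)\<close> stands for the unit triangle with centre \<open>p\<close> and vertices \<open>p + s *\<^sub>R T0_vertex j\<close>,
  which is positive for \<open>s = 1\<close> and negative for \<open>s = - 1\<close>.\<close>

definition tri_index :: "(point \<times> real) set" where
  "tri_index = {(p, s). (s = 1 \<or> s = - 1) \<and> (\<forall>i\<in>{1,2,3}. \<exists>n::int. p \<bullet> xi i = 3 * of_int n + 1 - s)}"

definition vert :: "point \<times> real \<Rightarrow> nat \<Rightarrow> point" where
  "vert t j = fst t + snd t *\<^sub>R T0_vertex j"

definition tri :: "point \<times> real \<Rightarrow> point set" where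
  "tri t = convex hull {vert t 1, vert t 2, vert t 3}"

definition side :: "point \<times> real \<Rightarrow> nat \<Rightarrow> point set" where
  "side t j = convex hull (vert t ` ({1,2,3} - {j}))"

lemma vert_coord:
  assumes "i \<in> {1,2,3}" "j \<in> {1,2,3}"
  shows "vert t j \<bullet> xi i = fst t \<bullet> xi i + snd t * (if i = j then - 2 else 1)"
  using T0_vertex_coord[OF assms] by (auto simp: vert_def inner_add_left)

lemma tri_index_sign: "t \<in> tri_index \<Longrightarrow> snd t = 1 \<or> snd t = - 1"
  by (auto simp: tri_index_def)

lemma vert_inj:
  assumes "t \<in> tri_index" "i \<in> {1,2,3}" "j \<in> {1,2,3}" "vert t i = vert t j"
  shows "i = j"
proof (rule ccontr)
  assume "i \<noteq> j"
  then have "snd t * - 2 = snd t"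
    using vert_coord[OF assms(2,2), of t] vert_coord[OF assms(2,3), of t] assms(4) by simp
  then show False
    using tri_index_sign[OF assms(1)] by auto
qed

lemma tri_affine_independent:
  assumes "t \<in> tri_index"
  shows "\<not> affine_dependent {vert t 1, vert t 2, vert t 3}"
proof
  have ne: "vert t 1 \<noteq> vert t 2" "vert t 1 \<noteq> vert t 3" "vert t 2 \<noteq> vert t 3"
    using vert_inj[OF assms] by force+
  assume "affine_dependent {vert t 1, vert t 2, vert t 3}"
  then obtain U where U: "U (vert t 1) + U (vert t 2) + U (vert t 3) = 0"
    and nz: "U (vert t 1) \<noteq> 0 \<or> U (vert t 2) \<noteq> 0 \<or> U (vert t 3) \<noteq> 0"
    and 0: "U (vert t 1) *\<^sub>R vert t 1 + U (vert t 2) *\<^sub>R vert t 2 + U (vert t 3) *\<^sub>R vert t 3 = 0"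
    using ne by (auto simp: affine_dependent_explicit_finite add.assoc)
  have "U (vert t i) = 0" if i: "i \<in> {1,2,3}" for i
  proof -
    have "U (vert t 1) * (vert t 1 \<bullet> xi i) + U (vert t 2) * (vert t 2 \<bullet> xi i) + U (vert t 3) * (vert t 3 \<bullet> xi i) = 0"
      using arg_cong[OF 0, of "\<lambda>x. x \<bullet> xi i"] by (simp add: inner_add_left)
    \<comment> \<open>Coordinate \<open>i\<close> has one value at the two other vertices and
      differs from it by \<open>3 * snd t\<close> at vertex \<open>i\<close>, so pairing with
      \<open>xi i\<close> isolates a single coefficient.\<close>
    then have "(U (vert t 1) + U (vert t 2) + U (vert t 3)) * (fst t \<bullet> xi i + snd t)
        - 3 * snd t * U (vert t i) = 0"
      using i by (auto simp: vert_coord algebra_simps)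
    then show ?thesis
      using U tri_index_sign[OF assms] by auto
  qed
  then show False
    using nz by blast
qed

lemma side_eq_segment:
  assumes "{i, j, k} = {1,2,3}" "i \<noteq> j" "i \<noteq> k"
  shows "side t i = closed_segment (vert t j) (vert t k)"
proof -
  have "{1,2,3} - {i} = {j, k}"
    using assms by blast
  then show ?thesis
    by (simp add: side_def segment_convex_hull)
qed

lemma side_coord:
  assumes "i \<in> {1,2,3}" "x \<in> side t i"
  shows "x \<bullet> xi i = fst t \<bullet> xi i + snd t"
proof -
  have "side t i \<subseteq> {x. xi i \<bullet> x = fst t \<bullet> xi i + snd t}"
    unfolding side_def
    using assms(1)
    by (intro hull_minimal convex_hyperplane) (auto simp: vert_coord inner_commute[of "xi _"])
  then show ?thesis
    using assms(2) by (auto simp: inner_commute)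
qed

lemma vert_in_side:
  assumes "j \<in> {1,2,3}" "i \<noteq> j"
  shows "vert t j \<in> side t i"
  unfolding side_def by (rule hull_inc) (use assms in auto)

lemma inj_on_side:
  assumes "t \<in> tri_index"
  shows "inj_on (side t) {1,2,3}"
proof (rule inj_onI, rule ccontr)
  fix i j :: nat assume i: "i \<in> {1,2,3}" and j: "j \<in> {1,2,3}" and eq: "side t i = side t j" and "i \<noteq> j"
  then have "vert t j \<in> side t j"
    using vert_in_side[OF j \<open>i \<noteq> j\<close>] by metis
  then have "snd t * - 2 = snd t"
    using side_coord[OF j] vert_coord[OF j j, of t] by fastforce
  then show False
    using tri_index_sign[OF assms] by auto
qed

text \<open>The faces of a simplex are the hulls of subsets of its vertices. Dimension 1 selects the
  two-element subsets, which are the complements of single vertices.\<close>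

lemma edges_of_tri:
  assumes t: "t \<in> tri_index"
  shows "{e. e edge_of tri t} = side t ` {1,2,3}"
proof -
  let ?V = "{vert t 1, vert t 2, vert t 3}"
  have V: "?V = vert t ` {1,2,3}" by simp
  have inj: "inj_on (vert t) {1,2,3}"
    by (intro inj_onI) (rule vert_inj[OF t])
  have ind: "\<not> affine_dependent ?V"
    by (rule tri_affine_independent[OF t])
  have aff: "aff_dim (convex hull (vert t ` J)) = int (card J) - 1" if "J \<subseteq> {1,2,3}" for J
  proof -
    have "\<not> affine_dependent (vert t ` J)"
      using ind that affine_dependent_subset unfolding V by (meson image_mono)
    then show ?thesis
      using card_image[OF inj_on_subset[OF inj that]] aff_dim_affine_independent[of "vert t ` J"]
      by (simp add: aff_dim_convex_hull)
  qed
  define I :: "nat set" where "I = {1,2,3}"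
  define f where "f J = convex hull (vert t ` J)" for J
  have face: "e face_of tri t \<longleftrightarrow> (\<exists>J\<subseteq>I. e = f J)" for e
    unfolding tri_def face_of_convex_hull_affine_independent[OF ind]
    unfolding V subset_image_iff I_def f_def by blast
  have dim: "aff_dim (f J) = 1 \<longleftrightarrow> card J = 2" if "J \<subseteq> I" for J
    using aff that unfolding f_def I_def by simp
  have edge: "e edge_of tri t \<longleftrightarrow> (\<exists>J. J \<subseteq> I \<and> card J = 2 \<and> e = f J)" for e
    unfolding edge_of_def face using dim by blast
  have pairs: "J \<subseteq> I \<and> card J = 2 \<longleftrightarrow> (\<exists>j\<in>I. J = I - {j})" for J
  proof
    assume J: "J \<subseteq> I \<and> card J = 2"
    then have "card (I - J) = 1"
      by (subst card_Diff_subset) (auto simp: I_def intro: finite_subset)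
    then obtain j where "I - J = {j}"
      by (rule card_1_singletonE)
    then show "\<exists>j\<in>I. J = I - {j}"
      using J by (intro bexI[of _ j]) blast+
  next
    assume "\<exists>j\<in>I. J = I - {j}"
    then show "J \<subseteq> I \<and> card J = 2"
      by (auto simp: insert_Diff_if I_def)
  qed
  have "e edge_of tri t \<longleftrightarrow> (\<exists>j\<in>I. e = f (I - {j}))" for e
    unfolding edge conj_assoc[symmetric] pairs by blast
  then show ?thesis
    by (auto simp: image_iff side_def f_def I_def)
qed

definition red_count :: "(nat \<Rightarrow> folding) \<Rightarrow> point \<times> real \<Rightarrow> nat" where
  "red_count S t = card {j \<in> {1,2,3}. pattern S (side t j) = Red}"

lemma red_sides_tri:
  assumes "t \<in> tri_index"
  shows "red_sides S (tri t) = red_count S t"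
proof -
  have "{e. e edge_of tri t \<and> pattern S e = Red} = side t ` {j \<in> {1,2,3}. pattern S (side t j) = Red}"
    (is "?L = ?R")
  proof -
    have "?L = {e \<in> {e. e edge_of tri t}. pattern S e = Red}" by simp
    also have "\<dots> = ?R"
      unfolding edges_of_tri[OF assms] by (simp only: image_Collect Collect_conj_eq) blast
    finally show ?thesis .
  qed
  moreover have "inj_on (side t) {j \<in> {1,2,3}. pattern S (side t j) = Red}"
    by (rule inj_on_subset[OF inj_on_side[OF assms]]) blast
  ultimately show ?thesis
    by (simp add: red_sides_def red_count_def card_image)
qed

lemma mem_tri:
  assumes "x \<in> tri t"
  obtains a b c where "0 \<le> a" "0 \<le> b" "0 \<le> c" "a + b + c = 1"
    "x = a *\<^sub>R vert t 1 + b *\<^sub>R vert t 2 + c *\<^sub>R vert t 3"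
  using assms unfolding tri_def convex_hull_3 by blast

lemma vert_in_tri:
  assumes "j \<in> {1,2,3}"
  shows "vert t j \<in> tri t"
  unfolding tri_def by (rule hull_inc) (use assms in auto)

lemma inner_xi_1: "x \<bullet> xi 1 = - 2 * sqrt 3 * x$2"
  by (simp add: xi_1 inner_point)

lemma height_less_iff: "x$2 < y$2 \<longleftrightarrow> y \<bullet> xi 1 < x \<bullet> xi 1"
  by (simp add: inner_xi_1)

lemma height_eq_iff: "x$2 = y$2 \<longleftrightarrow> x \<bullet> xi 1 = y \<bullet> xi 1"
  by (simp add: inner_xi_1)

text \<open>Since \<open>xi 1\<close> points down, a large first coordinate means a low point. A
  negative triangle has a unique lowest point, whereas a representation as required for
  \<open>Positive\<close> would provide two distinct ones, even if its points are not known to be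
  vertices.\<close>

lemma orientation_tri:
  assumes t: "t \<in> tri_index"
  shows "orientation (tri t) = (if snd t = 1 then Positive else Negative)"
proof (cases "snd t = 1")
  case True
  have "tri t = convex hull {vert t 2, vert t 3, vert t 1}"
    by (simp add: tri_def insert_commute)
  moreover have "vert t 2 \<noteq> vert t 3"
    using vert_inj[OF t, of 2 3] by auto
  moreover have "vert t 2 $ 2 = vert t 3 $ 2" "vert t 1 $ 2 > vert t 2 $ 2"
    unfolding height_less_iff height_eq_iff using True by (simp_all add: vert_coord)
  ultimately show ?thesis
    using True unfolding orientation_def by (metis (no_types, lifting))
next
  case False
  then have s: "snd t = - 1"
    using tri_index_sign[OF t] by blast
  have low: "x \<bullet> xi 1 < vert t 1 \<bullet> xi 1" if "x \<in> tri t" "x \<noteq> vert t 1" for x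
  proof -
    obtain a b c where abc: "0 \<le> a" "0 \<le> b" "0 \<le> c" "a + b + c = 1"
      and x: "x = a *\<^sub>R vert t 1 + b *\<^sub>R vert t 2 + c *\<^sub>R vert t 3"
      using mem_tri[OF \<open>x \<in> tri t\<close>] .
    have "b \<noteq> 0 \<or> c \<noteq> 0"
      using abc x that(2) by auto
    then have "0 < b + c"
      using abc by linarith
    moreover have "x \<bullet> xi 1 = (a + b + c) * (fst t \<bullet> xi 1) + 2 * (a + b + c) - 3 * (b + c)"
      unfolding x by (simp add: vert_coord s algebra_simps)
    ultimately show ?thesis
      by (simp add: abc(4) vert_coord s)
  qed
  have "\<not> (\<exists>a b c. tri t = convex hull {a, b, c} \<and> a \<noteq> b \<and> a$2 = b$2 \<and> c$2 > a$2)"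
  proof
    assume "\<exists>a b c. tri t = convex hull {a, b, c} \<and> a \<noteq> b \<and> a$2 = b$2 \<and> c$2 > a$2"
    then obtain a b c where T: "tri t = convex hull {a, b, c}" and "a \<noteq> b" and h: "a$2 = b$2" "c$2 > a$2"
      by blast
    have "tri t \<subseteq> {x. xi 1 \<bullet> x \<le> a \<bullet> xi 1}"
      unfolding T using h
      by (intro hull_minimal convex_halfspace_le) (auto simp: inner_commute[of "xi 1"] inner_xi_1)
    then have "vert t 1 \<bullet> xi 1 \<le> a \<bullet> xi 1"
      using vert_in_tri[of 1 t] by (auto simp: inner_commute)
    moreover have "a \<in> tri t" "b \<in> tri t"
      unfolding T by (auto intro: hull_inc)
    moreover have "a \<bullet> xi 1 = b \<bullet> xi 1"
      using h by (simp add: inner_xi_1)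
    ultimately have "a = vert t 1" "b = vert t 1"
      using low by force+
    then show False
      using \<open>a \<noteq> b\<close> by simp
  qed
  then show ?thesis
    using False unfolding orientation_def by auto
qed

lemma tri_coord_le:
  assumes t: "t \<in> tri_index" and "x \<in> tri t" and i: "i \<in> {1,2,3}"
  shows "snd t * (x \<bullet> xi i) \<le> snd t * (fst t \<bullet> xi i) + 1"
proof -
  obtain a b c where abc: "0 \<le> a" "0 \<le> b" "0 \<le> c" "a + b + c = 1"
    and x: "x = a *\<^sub>R vert t 1 + b *\<^sub>R vert t 2 + c *\<^sub>R vert t 3"
    using mem_tri[OF \<open>x \<in> tri t\<close>] .
  define d where "d = (if i = 1 then a else if i = 2 then b else c)"
  have "x \<bullet> xi i = (a + b + c) * (fst t \<bullet> xi i + snd t) - 3 * d * snd t"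
    unfolding x d_def using i by (auto simp: vert_coord algebra_simps)
  then have "x \<bullet> xi i = fst t \<bullet> xi i + snd t - 3 * d * snd t"
    by (simp add: abc(4))
  moreover have "0 \<le> d"
    using abc by (simp add: d_def)
  ultimately show ?thesis
    using tri_index_sign[OF t] by auto
qed

text \<open>The orientation recovers the sign. The maximum of
  \<open>snd t * (x \<bullet> xi i)\<close> over the triangle, attained on side \<open>i\<close>,
  recovers coordinate \<open>i\<close> of the centre.\<close>

lemma inj_on_tri: "inj_on tri tri_index"
proof (rule inj_onI)
  fix t t' assume t: "t \<in> tri_index" and t': "t' \<in> tri_index" and eq: "tri t = tri t'"
  have s: "snd t = snd t'"
    using orientation_tri[OF t] orientation_tri[OF t'] eq tri_index_sign[OF t] tri_index_sign[OF t']
    by (auto split: if_splits)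
  have le: "snd u * (fst v \<bullet> xi i) \<le> snd u * (fst u \<bullet> xi i)"
    if u: "u \<in> tri_index" "tri u = tri v" "snd u = snd v" and i: "i \<in> {1,2,3}" for u v i
  proof -
    obtain j where j: "j \<in> {1,2,3}" "i \<noteq> j"
      using i by fastforce
    have "snd u * (vert v j \<bullet> xi i) \<le> snd u * (fst u \<bullet> xi i) + 1"
      using tri_coord_le[OF u(1) _ i] vert_in_tri[OF j(1)] u(2) by metis
    then show ?thesis
      using j(2) u(3) tri_index_sign[OF u(1)] by (auto simp: vert_coord[OF i j(1)])
  qed
  have "fst t = fst t'"
  proof (rule coords_eqI)
    fix i :: nat assume i: "i \<in> {1,2,3}"
    show "fst t \<bullet> xi i = fst t' \<bullet> xi i"
      using le[OF t eq s i] le[OF t' eq[symmetric] s[symmetric] i] s tri_index_sign[OF t] by auto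
  qed
  then show "t = t'"
    using s by (simp add: prod_eq_iff)
qed

lemma tri_subset_ball: "tri t \<subseteq> ball 0 R \<longleftrightarrow> (\<forall>j\<in>{1,2,3}. norm (vert t j) < R)"
proof -
  have "tri t \<subseteq> ball 0 R \<longleftrightarrow> {vert t 1, vert t 2, vert t 3} \<subseteq> ball 0 R"
    unfolding tri_def by (rule subset_hull) (rule convex_ball)
  then show ?thesis
    by simp
qed

section \<open>The unit triangles are exactly the indexed ones\<close>

lemma segment_in_grid_line:
  assumes ab: "a \<noteq> b" and sub: "closed_segment a b \<subseteq> grid"
  obtains i n where "i \<in> {1,2,3}" "a \<bullet> xi i = 3 * of_int n + 1" "b \<bullet> xi i = 3 * of_int n + 1"
proof -
  let ?C = "\<lambda>p. closed_segment a b \<inter> grid_line (fst p) (snd p)"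
  let ?P = "{1,2,3} \<times> (UNIV :: int set)"
  have "closed_segment a b = (\<Union>p\<in>?P. ?C p)"
  proof
    show "closed_segment a b \<subseteq> (\<Union>p\<in>?P. ?C p)"
    proof
      fix x assume x: "x \<in> closed_segment a b"
      then obtain i n where "i \<in> {1,2,3}" "x \<in> grid_line i n"
        using sub unfolding grid_def by blast
      then show "x \<in> (\<Union>p\<in>?P. ?C p)"
        using x by (intro UN_I[of "(i, n)"]) auto
    qed
  qed blast
  \<comment> \<open>Countably many grid lines cover an uncountable segment, so one of them contains
    two of its points. The coordinate, affine along the segment, is then constant on it.\<close>
  moreover have "uncountable (closed_segment a b)"
    using ab by (simp add: uncountable_closed_segment)
  moreover have "countable (\<Union>p\<in>?P. ?C p)" if "\<forall>p\<in>?P. countable (?C p)"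
    by (intro countable_UN countable_SIGMA) (use that in auto)
  ultimately have "\<exists>p\<in>?P. \<not> countable (?C p)"
    by metis
  then obtain i n where i: "i \<in> {1,2,3}" and C: "\<not> countable (closed_segment a b \<inter> grid_line i n)"
    by auto
  have "\<exists>x y. x \<in> closed_segment a b \<inter> grid_line i n \<and> y \<in> closed_segment a b \<inter> grid_line i n \<and> x \<noteq> y"
  proof (rule ccontr)
    assume "\<not> ?thesis"
    then have "\<exists>z. closed_segment a b \<inter> grid_line i n \<subseteq> {z}"
      by blast
    then show False
      using C countable_subset by (metis countable_empty countable_insert)
  qed
  then obtain x y where x: "x \<in> closed_segment a b" "x \<bullet> xi i = 3 * of_int n + 1"
    and y: "y \<in> closed_segment a b" "y \<bullet> xi i = 3 * of_int n + 1" and "x \<noteq> y"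
    by (auto simp: grid_line_def)
  obtain t where t: "x = (1 - t) *\<^sub>R a + t *\<^sub>R b"
    using x(1) unfolding in_segment by blast
  obtain u where u: "y = (1 - u) *\<^sub>R a + u *\<^sub>R b"
    using y(1) unfolding in_segment by blast
  have "t \<noteq> u"
    using \<open>x \<noteq> y\<close> t u by blast
  let ?A = "a \<bullet> xi i" and ?B = "b \<bullet> xi i"
  have xt: "?A + t * (?B - ?A) = 3 * of_int n + 1"
    using x(2) unfolding t by (simp add: inner_add_left algebra_simps)
  have yu: "?A + u * (?B - ?A) = 3 * of_int n + 1"
    using y(2) unfolding u by (simp add: inner_add_left algebra_simps)
  have "(t - u) * (?B - ?A) = 0"
    using xt yu by (simp add: algebra_simps)
  then have "?B = ?A"
    using \<open>t \<noteq> u\<close> by simp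
  then show thesis
    using that[OF i, of n] xt by simp
qed

lemma dist_one_coords:
  assumes "dist a b = 1"
  shows "(a \<bullet> xi 1 - b \<bullet> xi 1)\<^sup>2 + (a \<bullet> xi 2 - b \<bullet> xi 2)\<^sup>2 + (a \<bullet> xi 3 - b \<bullet> xi 3)\<^sup>2 = 18"
  using norm_coords[of "a - b"] assms by (simp add: dist_norm inner_diff_left)

text \<open>With one difference zero, the other two are opposite, and their squares add up to
  18.\<close>

lemma dist_one_diff_3:
  assumes "dist a b = 1" and i: "i \<in> {1,2,3}" and j: "j \<in> {1,2,3}" "i \<noteq> j"
    and eq: "a \<bullet> xi i = b \<bullet> xi i"
  shows "\<bar>a \<bullet> xi j - b \<bullet> xi j\<bar> = 3"
proof -
  let ?d = "\<lambda>l. a \<bullet> xi l - b \<bullet> xi l"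
  define k where "k = 6 - i - j"
  have sum: "?d i + ?d j + ?d k = 0"
    and sq: "(?d i)\<^sup>2 + (?d j)\<^sup>2 + (?d k)\<^sup>2 = (?d 1)\<^sup>2 + (?d 2)\<^sup>2 + (?d 3)\<^sup>2"
    using i j coord_sum[of a] coord_sum[of b] by (auto simp: k_def simp flip: One_nat_def)
  have "?d k = - ?d j"
    using sum eq by linarith
  then have "(?d k)\<^sup>2 = (?d j)\<^sup>2"
    by (simp only: power2_minus)
  then have "2 * (?d j)\<^sup>2 = (?d 1)\<^sup>2 + (?d 2)\<^sup>2 + (?d 3)\<^sup>2"
    using sq eq by simp
  then have "(?d j)\<^sup>2 = 3\<^sup>2"
    using dist_one_coords[OF assms(1)] by simp
  then have "\<bar>?d j\<bar> = \<bar>3\<bar>"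
    by (simp only: power2_eq_iff abs_eq_iff)
  then show ?thesis
    by simp
qed

lemma tri_of_lines:
  assumes P: "\<And>i j. i \<in> {1,2,3} \<Longrightarrow> j \<in> {1,2,3} \<Longrightarrow> i \<noteq> j \<Longrightarrow> P j \<bullet> xi i = 3 * of_int (\<nu> i :: int) + 1"
    and d: "dist (P 1) (P 2) = 1"
  shows "\<exists>t\<in>tri_index. \<forall>j\<in>{1,2,3}. vert t j = P j"
proof -
  \<comment> \<open>The signed size of the triangle cut out by the three lines: coordinate
    \<open>j\<close> drops by \<open>3 * s\<close> from the line \<open>j\<close> to the opposite
    vertex. Distance 1 between two vertices then leaves only 1 and -1.\<close>
  define s where "s = \<nu> 1 + \<nu> 2 + \<nu> 3 + 1"
  have diag: "P j \<bullet> xi j = 3 * of_int (\<nu> j) + 1 - 3 * of_int s" if "j \<in> {1,2,3}" for j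
    using that coord_sum[of "P j"] P[of 1 j] P[of 2 j] P[of 3 j] by (auto simp: s_def)
  have "\<bar>P 1 \<bullet> xi 1 - P 2 \<bullet> xi 1\<bar> = 3"
    using dist_one_diff_3[OF d, of 3 1] P[of 3 1] P[of 3 2] by simp
  then have "\<bar>real_of_int s\<bar> = 1"
    using diag[of 1] P[of 1 2] by simp
  then have s: "real_of_int s = 1 \<or> real_of_int s = - 1"
    by linarith
  define t where "t = (P 1 - of_int s *\<^sub>R T0_vertex 1, real_of_int s)"
  have ft: "fst t \<bullet> xi i = 3 * of_int (\<nu> i) + 1 - of_int s" if "i \<in> {1,2,3}" for i
    using that diag[of 1] P[of i 1] T0_vertex_coord[OF that, of 1] by (auto simp: t_def inner_diff_left)
  have "t \<in> tri_index"
    using s ft unfolding tri_index_def by (auto simp: t_def)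
  moreover have "vert t j = P j" if "j \<in> {1,2,3}" for j
  proof (rule coords_eqI)
    fix i :: nat assume i: "i \<in> {1,2,3}"
    show "vert t j \<bullet> xi i = P j \<bullet> xi i"
      using vert_coord[OF i that, of t] ft[OF i] P[OF i that] diag[OF that] by (auto simp: t_def)
  qed
  ultimately show ?thesis
    by blast
qed

text \<open>On a common line, another coordinate would change by 3 or -3 along each side, and three
  such changes cannot add up to 0.\<close>

lemma collinear_not_equilateral:
  assumes "dist a b = 1" "dist b c = 1" "dist c a = 1" and i: "i \<in> {1,2,3}"
    and "a \<bullet> xi i = b \<bullet> xi i" "b \<bullet> xi i = c \<bullet> xi i"
  shows False
proof -
  obtain j where j: "j \<in> {1,2,3}" "i \<noteq> j"
    using i by fastforce
  show False
    using dist_one_diff_3[OF assms(1) i j] dist_one_diff_3[OF assms(2) i j]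
      dist_one_diff_3[OF assms(3) i j] assms(5,6) by linarith
qed

text \<open>The expression is the value of coordinate \<open>i\<close> on side \<open>i\<close>;
  membership in \<open>tri_index\<close> says that all three sides lie on grid lines.\<close>

lemma tri_index_vertex:
  assumes "t \<in> tri_index" "i \<in> {1,2,3}"
  obtains n :: int where "fst t \<bullet> xi i + snd t = 3 * of_int n + 1"
  using assms unfolding tri_index_def by fastforce

lemma vert_dist:
  assumes t: "t \<in> tri_index" and "i \<in> {1,2,3}" "j \<in> {1,2,3}" "i \<noteq> j"
  shows "dist (vert t i) (vert t j) = 1"
proof -
  have "(norm (vert t i - vert t j))\<^sup>2 = 1"
    unfolding norm_coords using assms(2-4) tri_index_sign[OF t]
    by (auto simp: inner_diff_left vert_coord)
  then have "norm (vert t i - vert t j) = 1"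
    using norm_ge_zero[of "vert t i - vert t j"] by (auto simp: power2_eq_1_iff)
  then show ?thesis
    by (simp add: dist_norm)
qed

lemma side_subset_grid:
  assumes t: "t \<in> tri_index" and i: "i \<in> {1,2,3}"
  shows "side t i \<subseteq> grid"
proof -
  obtain n where "fst t \<bullet> xi i + snd t = 3 * of_int n + 1"
    using tri_index_vertex[OF t i] .
  then have "side t i \<subseteq> grid_line i n"
    using side_coord[OF i, of _ t] by (auto simp: grid_line_def)
  then show ?thesis
    using i unfolding grid_def by blast
qed

lemma unit_triangles_eq: "unit_triangles = tri ` tri_index"
proof
  show "tri ` tri_index \<subseteq> unit_triangles"
  proof
    fix T assume "T \<in> tri ` tri_index"
    then obtain t where t: "t \<in> tri_index" and T: "T = tri t" by blast
    have "closed_segment (vert t 1) (vert t 2) \<subseteq> grid" "closed_segment (vert t 2) (vert t 3) \<subseteq> grid"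
      "closed_segment (vert t 3) (vert t 1) \<subseteq> grid"
      using side_subset_grid[OF t, of 3] side_subset_grid[OF t, of 1] side_subset_grid[OF t, of 2]
        side_eq_segment[of 3 1 2 t] side_eq_segment[of 1 2 3 t] side_eq_segment[of 2 3 1 t]
      by (simp_all add: insert_commute)
    moreover have "dist (vert t 1) (vert t 2) = 1" "dist (vert t 2) (vert t 3) = 1"
      "dist (vert t 3) (vert t 1) = 1"
      using vert_dist[OF t] by simp_all
    ultimately show "T \<in> unit_triangles"
      unfolding unit_triangles_def T tri_def by blast
  qed
next
  show "unit_triangles \<subseteq> tri ` tri_index"
  proof
    fix T assume "T \<in> unit_triangles"
    then obtain a b c where T: "T = convex hull {a, b, c}"
      and d: "dist a b = 1" "dist b c = 1" "dist c a = 1"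
      and g: "closed_segment a b \<subseteq> grid" "closed_segment b c \<subseteq> grid" "closed_segment c a \<subseteq> grid"
      unfolding unit_triangles_def by blast
    have "a \<noteq> b" "b \<noteq> c" "c \<noteq> a"
      using d by auto
    obtain i k where i: "i \<in> {1,2,3}" "b \<bullet> xi i = 3 * of_int k + 1" "c \<bullet> xi i = 3 * of_int k + 1"
      using segment_in_grid_line[OF \<open>b \<noteq> c\<close> g(2)] .
    obtain j l where j: "j \<in> {1,2,3}" "c \<bullet> xi j = 3 * of_int l + 1" "a \<bullet> xi j = 3 * of_int l + 1"
      using segment_in_grid_line[OF \<open>c \<noteq> a\<close> g(3)] .
    obtain h m where h: "h \<in> {1,2,3}" "a \<bullet> xi h = 3 * of_int m + 1" "b \<bullet> xi h = 3 * of_int m + 1"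
      using segment_in_grid_line[OF \<open>a \<noteq> b\<close> g(1)] .
    have ne: "i \<noteq> j" "j \<noteq> h" "h \<noteq> i"
      using collinear_not_equilateral[OF d] i j h by metis+
    then have perm: "{1,2,3} = {i, j, h}"
      using i(1) j(1) h(1) by auto
    \<comment> \<open>Relabels the vertices by the direction of the opposite side, as
      \<open>tri_of_lines\<close> expects; the three directions are distinct because an equilateral
      triangle is not collinear.\<close>
    define P where "P x = (if x = i then a else if x = j then b else c)" for x
    define \<nu> where "\<nu> x = (if x = i then k else if x = j then l else m)" for x
    have P: "P y \<bullet> xi x = 3 * of_int (\<nu> x) + 1" if "x \<in> {1,2,3}" "y \<in> {1,2,3}" "x \<noteq> y" for x y
      using that i j h ne unfolding perm by (auto simp: P_def \<nu>_def)
    have "dist (P x) (P y) = 1" if "x \<in> {1,2,3}" "y \<in> {1,2,3}" "x \<noteq> y" for x y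
      using that d ne unfolding perm by (auto simp: P_def dist_commute)
    then have "dist (P 1) (P 2) = 1"
      by simp
    then obtain t where t: "t \<in> tri_index" "\<forall>j\<in>{1,2,3}. vert t j = P j"
      using tri_of_lines[of P \<nu>, OF P] by blast
    have "{vert t 1, vert t 2, vert t 3} = P ` {1,2,3}"
      using t(2) by simp
    also have "\<dots> = {a, b, c}"
      unfolding perm using ne by (auto simp: P_def)
    finally show "T \<in> tri ` tri_index"
      using t(1) unfolding T tri_def by (intro image_eqI[of _ _ t]) simp_all
  qed
qed

subsection \<open>The substitution\<close>

text \<open>The triangle \<open>(-2)\<close> times \<open>t\<close> is cut into its central triangle \<open>child 0 t\<close> and the corner triangles
  \<open>child j t\<close> at the images of the vertices \<open>j = 1, 2, 3\<close>.\<close>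

definition child :: "nat \<Rightarrow> point \<times> real \<Rightarrow> point \<times> real" where
  "child j t = (if j = 0 then (- 2 *\<^sub>R fst t, snd t)
     else (- 2 *\<^sub>R fst t - snd t *\<^sub>R T0_vertex j, - snd t))"

lemma T0_vertex_sum:
  assumes "{i, j, k} = {1,2,3}" "i \<noteq> j" "j \<noteq> k" "i \<noteq> k"
  shows "T0_vertex i + T0_vertex j + T0_vertex k = 0"
proof -
  have "T0_vertex i + T0_vertex j + T0_vertex k = sum T0_vertex {i, j, k}"
    using assms(2-4) by (simp add: add.assoc)
  also have "\<dots> = T0_vertex 1 + T0_vertex 2 + T0_vertex 3"
    unfolding assms(1) by (simp add: add.assoc)
  also have "\<dots> = (- 1 / 6) *\<^sub>R (xi 1 + xi 2 + xi 3)"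
    by (simp add: T0_vertex_def scaleR_right_distrib)
  finally show ?thesis
    by (simp add: xi_sum)
qed

lemma vert_child_0:
  assumes "{i, j, k} = {1,2,3}" "i \<noteq> j" "j \<noteq> k" "i \<noteq> k"
  shows "vert (child 0 t) k = - vert t i - vert t j"
proof -
  have wk: "T0_vertex k = - T0_vertex i - T0_vertex j"
    using T0_vertex_sum[OF assms] by (simp add: algebra_simps eq_neg_iff_add_eq_0)
  show ?thesis
    unfolding vert_def wk by (simp add: child_def algebra_simps scaleR_2)
qed

lemma vert_child_corner:
  assumes "j \<noteq> 0"
  shows "vert (child j t) k = - vert t j - vert t k"
  using assms by (simp add: vert_def child_def algebra_simps scaleR_2)

section \<open>Colors of the sides of the four children\<close>

lemma cluster_vert:
  assumes t: "t \<in> tri_index" and J: "J \<subseteq> {1,2,3}"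
  shows "cluster (vert t ` J)"
proof -
  have "grid_vertex (vert t j)" if j: "j \<in> {1,2,3}" for j
    unfolding grid_vertex_def
  proof
    fix i :: nat assume i: "i \<in> {1,2,3}"
    obtain n where n: "fst t \<bullet> xi i + snd t = 3 * of_int n + 1"
      using tri_index_vertex[OF t i] .
    show "\<exists>n::int. vert t j \<bullet> xi i = 3 * of_int n + 1"
      using n tri_index_sign[OF t] vert_coord[OF i j, of t]
      by (intro exI[of _ "if i = j then if snd t = 1 then n - 1 else n + 1 else n"]) auto
  qed
  moreover have "\<bar>vert t j \<bullet> xi i - vert t k \<bullet> xi i\<bar> \<le> 3"
    if "i \<in> {1,2,3}" "j \<in> {1,2,3}" "k \<in> {1,2,3}" for i j k
    unfolding vert_coord[OF that(1,2)] vert_coord[OF that(1,3)] using tri_index_sign[OF t] by auto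
  ultimately show ?thesis
    unfolding cluster_def ball_simps(9) using subsetD[OF J] by (metis (no_types, lifting))
qed

lemma other_indices:
  assumes "i \<in> {1,2,3::nat}"
  obtains j k where "{i, j, k} = {1,2,3}" "i \<noteq> j" "j \<noteq> k" "i \<noteq> k" "j \<in> {1,2,3}" "k \<in> {1,2,3}"
proof -
  have "i = 1 \<or> i = 2 \<or> i = 3" using assms by simp
  then show thesis
  proof (elim disjE)
    assume "i = 1"
    then show thesis by (intro that[of 2 3]) auto
  next
    assume "i = 2"
    then show thesis by (intro that[of 1 3]) auto
  next
    assume "i = 3"
    then show thesis by (intro that[of 1 2]) auto
  qed
qed

lemma third_index:
  assumes "i \<in> {1,2,3::nat}" "j \<in> {1,2,3}" "i \<noteq> j"
  obtains k where "{i, j, k} = {1,2,3}" "j \<noteq> k" "i \<noteq> k" "k \<in> {1,2,3}"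
proof -
  have "\<exists>k\<in>{1,2,3}. j \<noteq> k \<and> i \<noteq> k"
    using assms by auto
  then obtain k where k: "k \<in> {1,2,3}" "j \<noteq> k" "i \<noteq> k"
    by blast
  moreover have "{i, j, k} = {1,2,3}"
    using assms k by auto
  ultimately show thesis
    using that by metis
qed

text \<open>The vertices add up to three times the centre, so the congruence modulo 9 in
  \<open>pattern_central\<close> is three times the congruence defining
  \<open>tri_index\<close>.\<close>

lemma pattern_child_0:
  assumes t: "t \<in> tri_index" and i: "i \<in> {1,2,3}"
  shows "pattern S (side (child 0 t) i) = crease_color (S 1) (snd t = 1)"
proof -
  obtain j k where jk: "{i, j, k} = {1,2,3}" "i \<noteq> j" "j \<noteq> k" "i \<noteq> k" "j \<in> {1,2,3}" "k \<in> {1,2,3}"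
    using other_indices[OF i] .
  have k: "vert (child 0 t) k = - vert t i - vert t j"
    using jk by (intro vert_child_0) auto
  have j: "vert (child 0 t) j = - vert t i - vert t k"
    using jk by (intro vert_child_0) auto
  have "side (child 0 t) i = closed_segment (- vert t i - vert t j) (- vert t i - vert t k)"
    using side_eq_segment[of i j k "child 0 t"] jk unfolding j k by (simp add: closed_segment_commute)
  moreover have "cluster {vert t i, vert t j, vert t k}"
    using cluster_vert[OF t, of "{i, j, k}"] unfolding jk(1)[symmetric] by simp
  moreover have "vert t j \<noteq> vert t k"
    using vert_inj[OF t] jk by blast
  moreover have "\<exists>n::int. (vert t i + vert t j + vert t k) \<bullet> xi l = 9 * of_int n + 3 * (1 - snd t)"
    if l: "l \<in> {1,2,3}" for l
  proof -
    obtain n :: int where n: "fst t \<bullet> xi l + snd t = 3 * of_int n + 1"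
      using tri_index_vertex[OF t l] .
    have "(vert t i + vert t j + vert t k) \<bullet> xi l
        = 3 * (fst t \<bullet> xi l) + snd t * ((T0_vertex i + T0_vertex j + T0_vertex k) \<bullet> xi l)"
      unfolding vert_def inner_add_left inner_scaleR_left by (simp add: algebra_simps)
    then have "(vert t i + vert t j + vert t k) \<bullet> xi l = 3 * (fst t \<bullet> xi l)"
      unfolding T0_vertex_sum[OF jk(1-4)] by simp
    then show ?thesis
      using n by (intro exI[of _ n]) simp
  qed
  ultimately show ?thesis
    using pattern_central tri_index_sign[OF t] by metis
qed

text \<open>This side is shared with the central child, so its color is already known.\<close>

lemma pattern_corner_inner:
  assumes t: "t \<in> tri_index" and j: "j \<in> {1,2,3}"
  shows "pattern S (side (child j t) j) = crease_color (S 1) (snd t = 1)"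
proof -
  obtain i k where ik: "{j, i, k} = {1,2,3}" "j \<noteq> i" "i \<noteq> k" "j \<noteq> k" "i \<in> {1,2,3}" "k \<in> {1,2,3}"
    using other_indices[OF j] .
  have 0: "j \<noteq> 0"
    using j by auto
  have "vert (child 0 t) i = - vert t j - vert t k" "vert (child 0 t) k = - vert t j - vert t i"
    using ik by (intro vert_child_0; auto)+
  then have "side (child j t) j = side (child 0 t) j"
    using side_eq_segment[of j i k "child 0 t"] side_eq_segment[of j i k "child j t"] ik
    unfolding vert_child_corner[OF 0] by (simp add: closed_segment_commute)
  then show ?thesis
    using pattern_child_0[OF t j] by simp
qed

lemma pattern_corner_outer:
  assumes t: "t \<in> tri_index" and j: "j \<in> {1,2,3}" and i: "i \<in> {1,2,3}" and "i \<noteq> j"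
  shows "pattern S (side (child j t) i) = pattern (\<lambda>n. S (Suc n)) (side t i)"
proof -
  obtain k where k: "{i, j, k} = {1,2,3}" "j \<noteq> k" "i \<noteq> k" "k \<in> {1,2,3}"
    using third_index[OF i j \<open>i \<noteq> j\<close>] .
  have 0: "j \<noteq> 0"
    using j by auto
  have "side (child j t) i = closed_segment (- 2 *\<^sub>R vert t j) (- vert t j - vert t k)"
    using side_eq_segment[OF k(1) \<open>i \<noteq> j\<close> k(3), of "child j t"] unfolding vert_child_corner[OF 0]
    by (simp add: scaleR_2)
  moreover have "cluster {vert t j, vert t k}"
    using cluster_vert[OF t, of "{j, k}"] j k by simp
  moreover have "vert t j \<noteq> vert t k"
    using vert_inj[OF t j] k by blast
  ultimately show ?thesis
    using pattern_half side_eq_segment[OF k(1) \<open>i \<noteq> j\<close> k(3), of t] by metis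
qed

lemma red_count_eq:
  "red_count S t = of_bool (pattern S (side t 1) = Red) + of_bool (pattern S (side t 2) = Red)
     + of_bool (pattern S (side t 3) = Red)"
proof -
  have "red_count S t = (\<Sum>j\<in>{1,2,3}. of_bool (pattern S (side t j) = Red))"
    unfolding red_count_def card_eq_sum of_bool_def by (rule sum.inter_filter) simp
  then show ?thesis
    by simp
qed

lemma red_count_le: "red_count S t \<le> 3"
  by (simp add: red_count_eq)

lemma red_count_child_0:
  assumes "t \<in> tri_index"
  shows "red_count S (child 0 t) = 3 * of_bool (crease_color (S 1) (snd t = 1) = Red)"
  by (simp add: red_count_eq pattern_child_0[OF assms])

text \<open>A corner triangle keeps the two half-sides at its corner and trades the third side
  of its parent for a side of the central triangle.\<close>

lemma red_count_corner:
  assumes t: "t \<in> tri_index" and j: "j \<in> {1,2,3}"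
  shows "red_count S (child j t) + of_bool (pattern (\<lambda>n. S (Suc n)) (side t j) = Red)
    = red_count (\<lambda>n. S (Suc n)) t + of_bool (crease_color (S 1) (snd t = 1) = Red)"
proof -
  have "j = 1 \<or> j = 2 \<or> j = 3"
    using j by simp
  then show ?thesis
    by (elim disjE) (simp_all add: red_count_eq pattern_corner_inner[OF t] pattern_corner_outer[OF t])
qed

text \<open>Corner \<open>j\<close> replaces side \<open>j\<close> of the parent by a midsegment of
  color \<open>b\<close>. The \<open>q\<close> corners opposite red sides thus have
  \<open>q + b - 1\<close> red sides and the others \<open>q + b\<close>; writing
  \<open>Suc r\<close> avoids truncated subtraction.\<close>

lemma red_corner_tally:
  fixes S :: "nat \<Rightarrow> folding"
  assumes t: "t \<in> tri_index"
  defines "b \<equiv> of_bool (crease_color (S 1) (snd t = 1) = Red)" and "q \<equiv> red_count (\<lambda>n. S (Suc n)) t"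
  shows "(\<Sum>j\<in>{1,2,3}. of_bool (red_count S (child j t) = r)) =
    (3 - real q) * of_bool (r = q + b) + real q * of_bool (Suc r = q + b)"
proof -
  define x :: "nat \<Rightarrow> nat" where "x j = of_bool (pattern (\<lambda>n. S (Suc n)) (side t j) = Red)" for j
  have x: "x j = 0 \<or> x j = 1" for j
    by (simp add: x_def)
  have q: "q = x 1 + x 2 + x 3"
    by (simp add: q_def red_count_eq x_def)
  have red_count: "red_count S (child j t) + x j = q + b" if "j \<in> {1,2,3}" for j
    using red_count_corner[OF t that, of S] by (simp add: q_def b_def x_def)
  have "of_bool (red_count S (child j t) = r) = (if x j = 1 then of_bool (Suc r = q + b) else of_bool (r = q + b) :: real)"
    if "j \<in> {1,2,3}" for j
    using red_count[OF that] x[of j] by auto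
  then have "(\<Sum>j\<in>{1,2,3}. of_bool (red_count S (child j t) = r)) =
      (\<Sum>j\<in>{1,2,3}. if x j = 1 then of_bool (Suc r = q + b) else of_bool (r = q + b) :: real)"
    by (rule sum.cong[OF refl])
  also have "\<dots> = (3 - real q) * of_bool (r = q + b) + real q * of_bool (Suc r = q + b)"
    using x[of 1] x[of 2] x[of 3] unfolding q by auto
  finally show ?thesis .
qed

section \<open>Every unit triangle has exactly one parent\<close>

lemma child_in_tri_index:
  assumes t: "t \<in> tri_index" and j: "j \<in> {0,1,2,3}"
  shows "child j t \<in> tri_index"
proof -
  have s: "snd t = 1 \<or> snd t = - 1"
    by (rule tri_index_sign[OF t])
  have "\<exists>n::int. fst (child j t) \<bullet> xi i = 3 * of_int n + 1 - snd (child j t)" if i: "i \<in> {1,2,3}" for i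
  proof -
    obtain n :: int where n: "fst t \<bullet> xi i + snd t = 3 * of_int n + 1"
      using tri_index_vertex[OF t i] .
    have "T0_vertex j \<bullet> xi i = (if i = j then - 2 else 1)" if "j \<noteq> 0"
      using T0_vertex_coord[OF i] that j by blast
    then show ?thesis
      using n s
      by (intro exI[of _ "if j = 0 then if snd t = 1 then - 2 * n else - 2 * n - 2
            else if i = j then if snd t = 1 then - 2 * n else - 2 * n - 2 else - 2 * n - 1"])
        (auto simp: child_def inner_diff_left)
  qed
  moreover have "snd (child j t) = 1 \<or> snd (child j t) = - 1"
    using s by (auto simp: child_def)
  ultimately show ?thesis
    by (simp add: tri_index_def case_prod_unfold)
qed

lemma tri_index_coord_int:
  assumes "t \<in> tri_index" "i \<in> {1,2,3}"
  obtains n :: int where "fst t \<bullet> xi i = of_int n"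
proof -
  obtain n :: int where "fst t \<bullet> xi i + snd t = 3 * of_int n + 1"
    using tri_index_vertex[OF assms] .
  then show thesis
    using tri_index_sign[OF assms(1)] that[of "if snd t = 1 then 3 * n else 3 * n + 2"] by auto
qed

lemma child_coord:
  assumes "i \<in> {1,2,3}" "j \<in> {0,1,2,3}"
  shows "fst (child j t) \<bullet> xi i
    = - 2 * (fst t \<bullet> xi i) - snd t * (if j = 0 then 0 else if i = j then - 2 else 1)"
proof (cases "j = 0")
  case False
  then have "T0_vertex j \<bullet> xi i = (if i = j then - 2 else 1)"
    using T0_vertex_coord[OF assms(1)] assms(2) by blast
  then show ?thesis
    using False by (auto simp: child_def inner_diff_left)
qed (simp add: child_def)

text \<open>The parities of the coordinates of the centre tell the four children apart.\<close>

lemma child_index_unique: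
  assumes t: "t \<in> tri_index" and t': "t' \<in> tri_index" and j: "j \<in> {0,1,2,3}" and j': "j' \<in> {0,1,2,3}"
    and eq: "child j t = child j' t'"
  shows "j = j'"
proof (rule ccontr)
  assume "j \<noteq> j'"
  define e where "e j i = (if j = 0 then 0 else if i = j then - 2 else 1 :: int)" for i j :: nat
  \<comment> \<open>The coordinates of a central child are all even; those of corner
    \<open>j\<close> are even only at \<open>j\<close>. So \<open>i = j\<close> separates two
    corners, and any index other than the corner separates it from the center.\<close>
  define i where "i = (if j \<noteq> 0 \<and> j' \<noteq> 0 then j else if j = 1 \<or> j' = 1 then 2 else 1)"
  have i: "i \<in> {1,2,3}"
    using j by (auto simp: i_def)
  have odd: "odd (e j i - e j' i) \<and> odd (e j i + e j' i)"
    using \<open>j \<noteq> j'\<close> j j' by (auto simp: i_def e_def)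
  obtain m where m: "fst t \<bullet> xi i = of_int m"
    using tri_index_coord_int[OF t i] .
  obtain m' where m': "fst t' \<bullet> xi i = of_int m'"
    using tri_index_coord_int[OF t' i] .
  have "- 2 * of_int m - snd t * of_int (e j i) = - 2 * of_int m' - snd t' * of_int (e j' i)"
    using child_coord[OF i j, of t] child_coord[OF i j', of t'] eq m m' by (auto simp: e_def)
  moreover obtain a b :: int where "snd t = of_int a" "snd t' = of_int b" "a = 1 \<or> a = - 1" "b = 1 \<or> b = - 1"
    using tri_index_sign[OF t] tri_index_sign[OF t']
    by (metis of_int_1 of_int_minus)
  ultimately have "real_of_int (- 2 * m - a * e j i) = real_of_int (- 2 * m' - b * e j' i)"
    by simp
  then have "- 2 * m - a * e j i = - 2 * m' - b * e j' i"
    by (simp only: of_int_eq_iff)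
  then have "even (a * e j i - b * e j' i)"
    by presburger
  then show False
    using odd \<open>a = 1 \<or> a = - 1\<close> \<open>b = 1 \<or> b = - 1\<close> by auto
qed

lemma child_inj:
  assumes "t \<in> tri_index" "t' \<in> tri_index" "j \<in> {0,1,2,3}" "j' \<in> {0,1,2,3}" "child j t = child j' t'"
  shows "j = j' \<and> t = t'"
  using child_index_unique[OF assms] assms(5) by (auto simp: child_def prod_eq_iff split: if_splits)

text \<open>The numbers \<open>n i\<close> have an even sum, so either all are even or exactly one
  is. In the first case the triangle is a central child, in the second the corner child with that
  index; the formula for \<open>child\<close> is then inverted.\<close>

lemma child_surj:
  assumes t: "t \<in> tri_index"
  obtains j t' where "j \<in> {0,1,2,3}" "t' \<in> tri_index" "child j t' = t"
proof -
  have "\<forall>i\<in>{1,2,3}. \<exists>n::int. fst t \<bullet> xi i = 3 * of_int n + 1 - snd t"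
    using t unfolding tri_index_def case_prod_unfold mem_Collect_eq by (rule conjunct2)
  from bchoice[OF this] obtain n :: "nat \<Rightarrow> int"
    where "\<forall>i\<in>{1,2,3}. fst t \<bullet> xi i = 3 * of_int (n i) + 1 - snd t"
    by (rule exE)
  then have n: "\<And>i. i \<in> {1,2,3} \<Longrightarrow> fst t \<bullet> xi i = 3 * of_int (n i) + 1 - snd t"
    by (rule bspec)
  have s: "snd t = 1 \<or> snd t = - 1"
    by (rule tri_index_sign[OF t])
  have "real_of_int (n 1 + n 2 + n 3) = real_of_int (if snd t = 1 then 0 else - 2)"
    using coord_sum[of "fst t"] n[of 1] n[of 2] n[of 3] s by auto
  then have sum: "n 1 + n 2 + n 3 = (if snd t = 1 then 0 else - 2)"
    by (simp only: of_int_eq_iff)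
  show thesis
  proof (cases "\<forall>i\<in>{1,2,3}. even (n i)")
    case True
    define t' where "t' = ((- 1 / 2) *\<^sub>R fst t, snd t)"
    have "\<exists>k::int. fst t' \<bullet> xi i = 3 * of_int k + 1 - snd t'" if i: "i \<in> {1,2,3}" for i
    proof -
      obtain m where m: "n i = 2 * m"
        using True i by blast
      show ?thesis
        using n[OF i] s unfolding m
        by (intro exI[of _ "if snd t = 1 then - m else - m - 1"]) (auto simp: t'_def field_simps)
    qed
    then have "t' \<in> tri_index"
      using s by (auto simp: tri_index_def t'_def)
    moreover have "child 0 t' = t"
      by (simp add: child_def t'_def prod_eq_iff)
    ultimately show thesis
      using that[of 0 t'] by blast
  next
    case False
    have "\<exists>j\<in>{1,2,3}. \<forall>i\<in>{1,2,3}. even (n i) \<longleftrightarrow> i = j"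
    proof -
      have "even (n 1 + n 2 + n 3)"
        unfolding sum by simp
      then show ?thesis
        using False by auto
    qed
    then obtain j where j: "j \<in> {1,2,3}" and par: "\<And>i. i \<in> {1,2,3} \<Longrightarrow> even (n i) \<longleftrightarrow> i = j"
      by blast
    define t' where "t' = ((1 / 2) *\<^sub>R (snd t *\<^sub>R T0_vertex j - fst t), - snd t)"
    have "\<exists>k::int. fst t' \<bullet> xi i = 3 * of_int k + 1 - snd t'" if i: "i \<in> {1,2,3}" for i
    proof (cases "i = j")
      case True
      then obtain m where m: "n i = 2 * m"
        using par[OF i] by blast
      show ?thesis
        using n[OF i] s T0_vertex_coord[OF i j] True unfolding m
        by (intro exI[of _ "if snd t = 1 then - m - 1 else - m"]) (auto simp: t'_def inner_diff_left field_simps)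
    next
      case False
      then obtain m where m: "n i = 2 * m + 1"
        using par[OF i] by (meson oddE)
      show ?thesis
        using n[OF i] s T0_vertex_coord[OF i j] False unfolding m
        by (intro exI[of _ "- m - 1"]) (auto simp: t'_def inner_diff_left field_simps)
    qed
    then have "t' \<in> tri_index"
      using s by (auto simp: tri_index_def t'_def)
    moreover have "child j t' = t"
      using j by (auto simp: child_def t'_def prod_eq_iff algebra_simps)
    ultimately show thesis
      using that[of j t'] j by blast
  qed
qed

text \<open>For equal signs some coordinate differs by a nonzero multiple of 3; for opposite signs
  all three differ by nonzero integers. Either way the squares add up to at least 3, so the squared
  distance is at least 1/6, which exceeds \<open>(2 / 5)\<^sup>2\<close>.\<close>

lemma tri_index_separated:
  assumes t: "t \<in> tri_index" and t': "t' \<in> tri_index" and ne: "t \<noteq> t'"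
  shows "2 / 5 \<le> dist (fst t) (fst t')"
proof -
  let ?d = "\<lambda>i. fst t \<bullet> xi i - fst t' \<bullet> xi i"
  have sq: "1 \<le> (?d i)\<^sup>2" "snd t = snd t' \<longrightarrow> 9 \<le> (?d i)\<^sup>2"
    if i: "i \<in> {1,2,3}" and nz: "?d i \<noteq> 0" for i
  proof -
    obtain n n' where n: "fst t \<bullet> xi i + snd t = 3 * of_int n + 1" "fst t' \<bullet> xi i + snd t' = 3 * of_int n' + 1"
      using tri_index_vertex[OF t i] tri_index_vertex[OF t' i] by metis
    obtain m m' where m: "fst t \<bullet> xi i = of_int m" "fst t' \<bullet> xi i = of_int m'"
      using tri_index_coord_int[OF t i] tri_index_coord_int[OF t' i] by metis
    have "1 \<le> \<bar>m - m'\<bar>"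
      using nz m by auto
    then have "1 \<le> \<bar>?d i\<bar>"
      unfolding m by linarith
    then show "1 \<le> (?d i)\<^sup>2"
      using abs_le_square_iff[of 1 "?d i"] by simp
    show "snd t = snd t' \<longrightarrow> 9 \<le> (?d i)\<^sup>2"
    proof
      assume "snd t = snd t'"
      then have d: "?d i = 3 * of_int n - 3 * of_int n'"
        using n by simp
      then have "1 \<le> \<bar>n - n'\<bar>"
        using nz by auto
      then have "1 \<le> \<bar>real_of_int n - real_of_int n'\<bar>"
        by linarith
      then have "3 \<le> \<bar>?d i\<bar>"
        unfolding d by linarith
      then show "9 \<le> (?d i)\<^sup>2"
        using abs_le_square_iff[of 3 "?d i"] by simp
    qed
  qed
  have "3 \<le> (?d 1)\<^sup>2 + (?d 2)\<^sup>2 + (?d 3)\<^sup>2"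
  proof (cases "snd t = snd t'")
    case True
    then have "\<exists>i\<in>{1,2,3}. ?d i \<noteq> 0"
      using ne coords_eqI[of "fst t" "fst t'"] by (auto simp: prod_eq_iff)
    then obtain i where "i \<in> {1,2,3}" and i9: "9 \<le> (?d i)\<^sup>2"
      using sq True by blast
    then have "i = 1 \<or> i = 2 \<or> i = 3"
      by simp
    then show ?thesis
      using i9 zero_le_power2[of "?d 1"] zero_le_power2[of "?d 2"] zero_le_power2[of "?d 3"]
      by (elim disjE) (hypsubst, linarith)+
  next
    case False
    have "?d i \<noteq> 0" if i: "i \<in> {1,2,3}" for i
    proof
      assume "?d i = 0"
      obtain n n' where n: "fst t \<bullet> xi i + snd t = 3 * of_int n + 1" "fst t' \<bullet> xi i + snd t' = 3 * of_int n' + 1"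
        using tri_index_vertex[OF t i] tri_index_vertex[OF t' i] by metis
      have "real_of_int (3 * n - 3 * n') = snd t - snd t'"
        using n \<open>?d i = 0\<close> by simp
      then have "real_of_int (3 * n - 3 * n') = of_int 2 \<or> real_of_int (3 * n - 3 * n') = of_int (- 2)"
        using False tri_index_sign[OF t] tri_index_sign[OF t'] by auto
      then have "3 * n - 3 * n' = 2 \<or> 3 * n - 3 * n' = - 2"
        unfolding of_int_eq_iff .
      then show False
        by presburger
    qed
    then show ?thesis
      using sq(1)[of 1] sq(1)[of 2] sq(1)[of 3] by simp
  qed
  then have "(2 / 5)\<^sup>2 \<le> (norm (fst t - fst t'))\<^sup>2"
    unfolding norm_coords by (simp add: inner_diff_left power2_eq_square)
  then show ?thesis
    by (simp add: dist_norm power2_le_iff_abs_le)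
qed

subsection \<open>Packing estimates\<close>

text \<open>Discs of radius 1/5 about distinct centres are disjoint by
  \<open>tri_index_separated\<close>; comparing areas gives the bound after cancelling
  \<open>pi\<close>.\<close>

lemma tri_index_packing:
  assumes F: "F \<subseteq> tri_index" "finite F" and r: "0 \<le> r" "r \<le> R"
    and sub: "\<And>t. t \<in> F \<Longrightarrow> ball (fst t) (1 / 5) \<subseteq> ball 0 R - ball 0 r"
  shows "real (card F) \<le> 25 * (R\<^sup>2 - r\<^sup>2)"
proof -
  have "pairwise (\<lambda>t t'. disjnt (ball (fst t) (1 / 5)) (ball (fst t') (1 / 5))) F"
  proof (rule pairwiseI)
    fix t t' assume "t \<in> F" "t' \<in> F" "t \<noteq> t'"
    then have "2 / 5 \<le> dist (fst t) (fst t')"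
      using tri_index_separated F(1) by blast
    then have "dist (fst t') x \<ge> 1 / 5" if "dist (fst t) x < 1 / 5" for x
      using that dist_triangle2[of "fst t" "fst t'" x] by linarith
    then show "disjnt (ball (fst t) (1 / 5)) (ball (fst t') (1 / 5))"
      unfolding disjnt_iff mem_ball by (meson not_le)
  qed
  then have "measure lebesgue (\<Union>t\<in>F. ball (fst t) (1 / 5)) = (\<Sum>t\<in>F. measure lebesgue (ball (fst t) (1 / 5)))"
    by (intro measure_UNION' F) auto
  also have "\<dots> = real (card F) * (pi / 25)"
    by (simp add: circle_area power2_eq_square)
  finally have "real (card F) * (pi / 25) = measure lebesgue (\<Union>t\<in>F. ball (fst t) (1 / 5))"
    by simp
  also have "\<dots> \<le> measure lebesgue (ball 0 R - ball 0 r :: point set)"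
    using sub F(2) by (intro measure_mono_fmeasurable) (auto intro!: fmeasurable.Diff)
  also have "\<dots> = measure lebesgue (ball 0 R :: point set) - measure lebesgue (ball 0 r :: point set)"
    using r by (intro measurable_measure_Diff) (auto simp: subset_ball)
  also have "\<dots> = (R\<^sup>2 - r\<^sup>2) * pi"
    using r by (simp add: circle_area algebra_simps)
  finally have "(real (card F) / 25) * pi \<le> (R\<^sup>2 - r\<^sup>2) * pi"
    by simp
  then show ?thesis
    using pi_gt_zero by simp
qed

definition tris_in :: "real \<Rightarrow> (point \<times> real) set" where
  "tris_in R = {t \<in> tri_index. \<forall>j\<in>{1,2,3}. norm (vert t j) < R}"

lemma norm_T0_vertex:
  assumes "j \<in> {1,2,3}"
  shows "norm (T0_vertex j) < 1"
proof -
  have "(norm (T0_vertex j))\<^sup>2 < 1\<^sup>2"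
    unfolding norm_coords using assms by (auto simp: T0_vertex_coord)
  then show ?thesis
    by (rule power_less_imp_less_base) simp
qed

lemma norm_sign_T0_vertex:
  assumes "t \<in> tri_index" "j \<in> {1,2,3}"
  shows "norm (snd t *\<^sub>R T0_vertex j) < 1"
  using tri_index_sign[OF assms(1)] norm_T0_vertex[OF assms(2)] by auto

lemma norm_vert_fst:
  assumes "t \<in> tri_index" "j \<in> {1,2,3}"
  shows "norm (vert t j) < norm (fst t) + 1" "norm (fst t) < norm (vert t j) + 1"
proof -
  show "norm (vert t j) < norm (fst t) + 1"
    using norm_triangle_ineq[of "fst t" "snd t *\<^sub>R T0_vertex j"] norm_sign_T0_vertex[OF assms] by (simp add: vert_def)
  show "norm (fst t) < norm (vert t j) + 1"
    using norm_triangle_ineq4[of "vert t j" "snd t *\<^sub>R T0_vertex j"] norm_sign_T0_vertex[OF assms] by (simp add: vert_def)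
qed

lemma norm_child:
  assumes t: "t \<in> tri_index" and j: "j \<in> {0,1,2,3}"
  shows "2 * norm (fst t) - 1 \<le> norm (fst (child j t))"
proof (cases "j = 0")
  case False
  then have "norm (snd t *\<^sub>R T0_vertex j) < 1"
    using norm_sign_T0_vertex[OF t] j by blast
  moreover have "norm (- 2 *\<^sub>R fst t) - norm (snd t *\<^sub>R T0_vertex j) \<le> norm (fst (child j t))"
    using norm_triangle_ineq2[of "- 2 *\<^sub>R fst t" "snd t *\<^sub>R T0_vertex j"] False by (simp add: child_def)
  ultimately show ?thesis
    by simp
qed (simp add: child_def)

lemma ball_subset_annulus:
  assumes "r + 1 \<le> norm x" "norm x < R - 1"
  shows "ball x (1 / 5) \<subseteq> ball 0 R - ball 0 (r::real)"
proof
  fix y assume "y \<in> ball x (1 / 5)"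
  then have "norm (x - y) < 1 / 5"
    by (simp add: dist_norm)
  then show "y \<in> ball 0 R - ball 0 r"
    using assms norm_triangle_ineq2[of x y] norm_triangle_ineq3[of x y] by auto
qed

lemma tris_in_finite_card:
  assumes "0 \<le> R"
  shows "finite (tris_in R) \<and> real (card (tris_in R)) \<le> 25 * (R + 2)\<^sup>2"
proof -
  have le: "real (card G) \<le> 25 * (R + 2)\<^sup>2" if G: "G \<subseteq> tris_in R" "finite G" for G
  proof -
    have "ball (fst t) (1 / 5) \<subseteq> ball 0 (R + 2) - ball 0 0" if "t \<in> G" for t
    proof -
      have "t \<in> tri_index" "norm (vert t 1) < R"
        using that G(1) by (auto simp: tris_in_def)
      then have "norm (fst t) < R + 1"
        using norm_vert_fst(2)[of t 1] by simp
      \<comment> \<open>The inner radius -1 denotes an empty ball, so the lower bound on the norm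
        becomes trivial.\<close>
      then have "ball (fst t) (1 / 5) \<subseteq> ball 0 (R + 2) - ball 0 (- 1)"
        by (intro ball_subset_annulus) auto
      then show ?thesis
        by auto
    qed
    then show ?thesis
      using tri_index_packing[of G 0 "R + 2"] G assms by (auto simp: tris_in_def)
  qed
  have "finite (tris_in R) \<and> card (tris_in R) \<le> nat \<lfloor>25 * (R + 2)\<^sup>2\<rfloor>"
    by (rule finite_if_finite_subsets_card_bdd) (use le in \<open>simp add: le_nat_floor\<close>)
  then show ?thesis
    using le by blast
qed

section \<open>The substitution on discs and its boundary error\<close>

definition children :: "(point \<times> real) set \<Rightarrow> (point \<times> real) set" where
  "children A = (\<lambda>(j, t). child j t) ` ({0,1,2,3} \<times> A)"

lemma mem_image_Times: "u \<in> (\<lambda>(j, t). f j t) ` (J \<times> A) \<longleftrightarrow> (\<exists>j\<in>J. \<exists>t\<in>A. u = f j t)"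
  by auto

lemma mem_children: "u \<in> children A \<longleftrightarrow> (\<exists>j\<in>{0,1,2,3}. \<exists>t\<in>A. u = child j t)"
  unfolding children_def by (rule mem_image_Times)

lemma inj_on_child:
  assumes "A \<subseteq> tri_index"
  shows "inj_on (\<lambda>(j, t). child j t) ({0,1,2,3} \<times> A)"
proof (rule inj_onI)
  fix x y :: "nat \<times> point \<times> real"
  assume x: "x \<in> {0,1,2,3} \<times> A" and y: "y \<in> {0,1,2,3} \<times> A"
    and eq: "(case x of (j, t) \<Rightarrow> child j t) = (case y of (j, t) \<Rightarrow> child j t)"
  obtain j t where jt: "x = (j, t)" by (cases x)
  obtain j' t' where jt': "y = (j', t')" by (cases y)
  have "t \<in> tri_index" "t' \<in> tri_index" "j \<in> {0,1,2,3}" "j' \<in> {0,1,2,3}" "child j t = child j' t'"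
    using x y eq subsetD[OF assms] unfolding jt jt' mem_Sigma_iff case_prod_conv by simp_all
  then show "x = y"
    using child_inj jt jt' by blast
qed

lemma sum_children:
  assumes "A \<subseteq> tri_index" "finite A"
  shows "(\<Sum>t\<in>children A. f t) = (\<Sum>t\<in>A. f (child 0 t) + (\<Sum>j\<in>{1,2,3}. f (child j t)))"
    (is "?L = ?R")
proof -
  have "?L = (\<Sum>(j, t)\<in>{0,1,2,3} \<times> A. f (child j t))"
    unfolding children_def by (subst sum.reindex[OF inj_on_child[OF assms(1)]]) (simp add: case_prod_unfold)
  also have "\<dots> = (\<Sum>j\<in>{0,1,2,3}. \<Sum>t\<in>A. f (child j t))"
    by (simp add: sum.cartesian_product)
  also have "\<dots> = (\<Sum>t\<in>A. \<Sum>j\<in>{0,1,2,3}. f (child j t))"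
    by (rule sum.swap)
  also have "\<dots> = ?R"
    by simp
  finally show ?thesis .
qed

lemma finite_children: "finite A \<Longrightarrow> finite (children A)"
  by (simp add: children_def)

lemma card_children:
  assumes "A \<subseteq> tri_index" "finite A"
  shows "card (children A) = 4 * card A"
  unfolding children_def card_image[OF inj_on_child[OF assms(1)]]
  by (simp add: card_cartesian_product)

text \<open>Every vertex of a child is minus the sum of two vertices of the parent, possibly equal
  ones, so norms at most double.\<close>

lemma children_tris_in: "children (tris_in (R / 2)) \<subseteq> tris_in R"
proof
  fix u assume "u \<in> children (tris_in (R / 2))"
  then obtain j t where j: "j \<in> {0,1,2,3}" and "t \<in> tris_in (R / 2)" and u: "u = child j t"
    unfolding mem_children by (elim bexE)
  then have t: "t \<in> tri_index" and v: "\<And>i. i \<in> {1,2,3} \<Longrightarrow> norm (vert t i) < R / 2"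
    unfolding tris_in_def by auto
  have "norm (vert u k) < R" if k: "k \<in> {1,2,3}" for k
  proof -
    have "\<exists>a\<in>{1,2,3}. \<exists>b\<in>{1,2,3}. vert u k = - vert t a - vert t b"
    proof (cases "j = 0")
      case True
      obtain a b where ab: "{k, a, b} = {1,2,3}" "k \<noteq> a" "a \<noteq> b" "k \<noteq> b" "a \<in> {1,2,3}" "b \<in> {1,2,3}"
        using other_indices[OF k] .
      have "vert (child 0 t) k = - vert t a - vert t b"
        using ab by (intro vert_child_0) auto
      then show ?thesis
        unfolding u True using ab(5,6) by blast
    next
      case False
      then show ?thesis
        unfolding u using vert_child_corner[OF False] j k by blast
    qed
    then obtain a b where "norm (vert t a) < R / 2" "norm (vert t b) < R / 2"
      and "vert u k = - vert t a - vert t b"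
      using v by blast
    then show ?thesis
      using norm_triangle_ineq4[of "- vert t a" "vert t b"] by simp
  qed
  then show "u \<in> tris_in R"
    unfolding tris_in_def u using child_in_tri_index[OF t j] by blast
qed

text \<open>The parent of a missed triangle has a vertex of norm at least \<open>R / 2\<close>,
  which puts the centre of the child between radii \<open>R - 3\<close> and \<open>R + 1\<close>.
  Packing in a slightly larger annulus gives a linear bound; the constant 900 is
  \<open>25 * 6\<^sup>2\<close>, from the trivial bound for \<open>R \<le> 4\<close>.\<close>

lemma card_boundary:
  assumes R: "0 \<le> R"
  shows "real (card (tris_in R - children (tris_in (R / 2)))) \<le> 900 * (R + 1)"
proof -
  let ?B = "tris_in R - children (tris_in (R / 2))"
  have fin: "finite (tris_in R)" and total: "real (card (tris_in R)) \<le> 25 * (R + 2)\<^sup>2"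
    using tris_in_finite_card[OF R] by auto
  show ?thesis
  proof (cases "R \<le> 4")
    case True
    have "real (card ?B) \<le> real (card (tris_in R))"
      using fin by (simp add: card_mono)
    also note total
    also have "25 * (R + 2)\<^sup>2 \<le> 25 * 6\<^sup>2"
      using R True by (intro mult_left_mono power_mono) auto
    finally show ?thesis
      using R by simp
  next
    case False
    have "ball (fst u) (1 / 5) \<subseteq> ball 0 (R + 2) - ball 0 (R - 4)" if u: "u \<in> ?B" for u
    proof -
      have ui: "u \<in> tri_index" "norm (vert u 1) < R"
        using u by (auto simp: tris_in_def)
      obtain j t where j: "j \<in> {0,1,2,3}" and t: "t \<in> tri_index" and ch: "child j t = u"
        using child_surj[OF ui(1)] .
      have "t \<notin> tris_in (R / 2)"
        using u j ch unfolding Diff_iff mem_children by metis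
      then obtain i where "i \<in> {1,2,3}" "R / 2 \<le> norm (vert t i)"
        using t unfolding tris_in_def by (auto simp: not_less)
      then have "R - 3 \<le> norm (fst u)"
        using norm_vert_fst(1)[OF t] norm_child[OF t j] unfolding ch by force
      moreover have "norm (fst u) < R + 1"
        using norm_vert_fst(2)[OF ui(1), of 1] ui(2) by simp
      ultimately show ?thesis
        by (intro ball_subset_annulus) auto
    qed
    then have "real (card ?B) \<le> 25 * ((R + 2)\<^sup>2 - (R - 4)\<^sup>2)"
      using fin False by (intro tri_index_packing) (auto simp: tris_in_def)
    also have "\<dots> \<le> 900 * (R + 1)"
      using R by (simp add: power2_eq_square algebra_simps)
    finally show ?thesis .
  qed
qed

text \<open>Doubling the radius at least quadruples the count, since children stay inside. The
  induction over dyadic ranges starts from \<open>T0\<close> alone for radii between 1 and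
  2.\<close>

lemma card_tris_in_ge:
  assumes "1 \<le> R"
  shows "R\<^sup>2 / 4 \<le> real (card (tris_in R))"
proof -
  have small: "R\<^sup>2 / 4 \<le> real (card (tris_in R))" if "1 \<le> R" "R < 2" for R
  proof -
    have "(0, 1) \<in> tri_index"
      by (auto simp: tri_index_def intro: exI[of _ 0])
    then have "(0, 1) \<in> tris_in R"
      using norm_T0_vertex that unfolding tris_in_def by (force simp: vert_def)
    then have "card (tris_in R) \<noteq> 0"
      using tris_in_finite_card[of R] that by auto
    then have "1 \<le> real (card (tris_in R))"
      by simp
    moreover have "R\<^sup>2 \<le> 2\<^sup>2"
      using that by (intro power_mono) auto
    ultimately show ?thesis
      by simp
  qed
  have "\<forall>R. 1 \<le> R \<longrightarrow> R < 2 ^ Suc n \<longrightarrow> R\<^sup>2 / 4 \<le> real (card (tris_in R))" for n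
  proof (induction n)
    case 0
    then show ?case using small by simp
  next
    case (Suc n)
    show ?case
    proof (intro allI impI)
      fix R :: real assume R: "1 \<le> R" "R < 2 ^ Suc (Suc n)"
      show "R\<^sup>2 / 4 \<le> real (card (tris_in R))"
      proof (cases "R < 2")
        case False
        have half: "finite (tris_in (R / 2))" "tris_in (R / 2) \<subseteq> tri_index"
          using tris_in_finite_card[of "R / 2"] R by (auto simp: tris_in_def)
        have "(R / 2)\<^sup>2 / 4 \<le> real (card (tris_in (R / 2)))"
          using Suc R False by simp
        then have "R\<^sup>2 / 4 \<le> real (card (children (tris_in (R / 2))))"
          using card_children[OF half(2,1)] by (simp add: power_divide)
        also have "\<dots> \<le> real (card (tris_in R))"
          using children_tris_in tris_in_finite_card[of R] R by (simp add: card_mono)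
        finally show ?thesis .
      qed (use small R in simp)
    qed
  qed
  moreover obtain n where "R < 2 ^ n"
    using real_arch_pow[of 2 R] by auto
  then have "R < 2 ^ Suc n"
    using assms by simp
  ultimately show ?thesis
    using assms by blast
qed

subsection \<open>Discrepancy\<close>

definition type_count :: "(nat \<Rightarrow> folding) \<Rightarrow> (point \<times> real) set \<Rightarrow> real \<Rightarrow> nat \<Rightarrow> real" where
  "type_count S A s r = (\<Sum>t\<in>A. of_bool (snd t = s \<and> red_count S t = r))"

definition sign_count :: "(point \<times> real) set \<Rightarrow> real \<Rightarrow> real" where
  "sign_count A s = (\<Sum>t\<in>A. of_bool (snd t = s))"

lemma sum_by_red:
  assumes "finite A"
  shows "(\<Sum>t\<in>A. of_bool (snd t = s) * g (red_count S t)) = (\<Sum>q\<in>{0,1,2,3}. g q * type_count S A s q)"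
proof -
  have "of_bool (snd t = s) * g (red_count S t) = (\<Sum>q\<in>{0,1,2,3}. g q * of_bool (snd t = s \<and> red_count S t = q))" for t
  proof -
    have "red_count S t \<in> {0,1,2,3}"
      using red_count_le[of S t] by auto
    then show ?thesis
      by auto
  qed
  then show ?thesis
    unfolding type_count_def sum_distrib_left by (simp only: sum.swap[of _ A])
qed

lemma sign_count_eq:
  assumes "finite A"
  shows "sign_count A s = type_count S A s 0 + type_count S A s 1 + type_count S A s 2 + type_count S A s 3"
  using sum_by_red[OF assms, of s "\<lambda>_. 1" S] by (simp add: sign_count_def)

lemma card_eq_sign_count:
  assumes "A \<subseteq> tri_index" "finite A"
  shows "real (card A) = sign_count A 1 + sign_count A (- 1)"
proof -
  have "of_bool (snd t = 1) + of_bool (snd t = - 1) = (1 :: real)" if "t \<in> A" for t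
    using tri_index_sign[OF subsetD[OF assms(1) that]] by auto
  then show ?thesis
    unfolding sign_count_def sum.distrib[symmetric] by simp
qed

text \<open>The rows of the substitution matrix. Central children keep the sign and have 0 or 3 red
  sides; corners reverse it, so those of sign \<open>s\<close> come from parents of sign
  \<open>- s\<close> and acquire a midsegment of color \<open>b (- s)\<close>.\<close>

lemma type_count_children:
  fixes S :: "nat \<Rightarrow> folding"
  defines "b \<equiv> \<lambda>s::real. of_bool (crease_color (S 1) (s = 1) = Red) :: nat"
  assumes A: "A \<subseteq> tri_index" "finite A" and s: "s = 1 \<or> s = - 1"
  shows "type_count S (children A) s r = of_bool (3 * b s = r) * sign_count A s
    + (\<Sum>q\<in>{0,1,2,3}. ((3 - real q) * of_bool (r = q + b (- s)) + real q * of_bool (Suc r = q + b (- s)))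
          * type_count (\<lambda>n. S (Suc n)) A (- s) q)"
proof -
  let ?g = "\<lambda>q. (3 - real q) * of_bool (r = q + b (- s)) + real q * of_bool (Suc r = q + b (- s))"
  have "of_bool (snd (child 0 t) = s \<and> red_count S (child 0 t) = r)
      + (\<Sum>j\<in>{1,2,3}. of_bool (snd (child j t) = s \<and> red_count S (child j t) = r))
    = of_bool (3 * b s = r) * of_bool (snd t = s) + of_bool (snd t = - s) * ?g (red_count (\<lambda>n. S (Suc n)) t)"
    if "t \<in> A" for t
  proof -
    have t: "t \<in> tri_index"
      using A(1) that by blast
    have "of_bool (snd (child 0 t) = s \<and> red_count S (child 0 t) = r) = of_bool (3 * b s = r) * (of_bool (snd t = s) :: real)"
      using red_count_child_0[OF t, of S] by (auto simp: child_def b_def)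
    moreover have "(\<Sum>j\<in>{1,2,3}. of_bool (snd (child j t) = s \<and> red_count S (child j t) = r))
        = of_bool (snd t = - s) * (\<Sum>j\<in>{1,2,3}. of_bool (red_count S (child j t) = r) :: real)"
      unfolding sum_distrib_left by (rule sum.cong) (auto simp: child_def)
    moreover have "of_bool (snd t = - s) * (\<Sum>j\<in>{1,2,3}. of_bool (red_count S (child j t) = r))
        = of_bool (snd t = - s) * ?g (red_count (\<lambda>n. S (Suc n)) t)"
    proof (cases "snd t = - s")
      case True
      then show ?thesis
        unfolding red_corner_tally[OF t] b_def by simp
    qed simp
    ultimately show ?thesis
      by simp
  qed
  then show ?thesis
    unfolding type_count_def[of S "children A"] sum_children[OF A] sum_by_red[OF A(2), symmetric] sign_count_def
      sum_distrib_left sum.distrib[symmetric]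
    by (intro sum.cong) auto
qed

text \<open>All central triangles of one orientation have the same type, so a surplus of one orientation enters
  the count of that type with full weight; the last summand compensates for this.\<close>

definition discrepancy :: "(nat \<Rightarrow> folding) \<Rightarrow> (point \<times> real) set \<Rightarrow> real" where
  "discrepancy S A = (\<Sum>s\<in>{1,-1}. \<Sum>r\<in>{0,1,2,3}. \<bar>type_count S A s r - (sign_count A 1 + sign_count A (- 1)) / 8\<bar>)
     + \<bar>sign_count A 1 - sign_count A (- 1)\<bar>"

lemma crease_color_sign:
  "crease_color c False = Red \<longleftrightarrow> crease_color c True \<noteq> Red"
  by (cases c) auto

section \<open>The deviation from uniformity grows at most by the factor 3\<close>

definition deviation :: "(nat \<Rightarrow> real) \<Rightarrow> (nat \<Rightarrow> real) \<Rightarrow> real" where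
  "deviation p q = (let P = p 0 + p 1 + p 2 + p 3; Q = q 0 + q 1 + q 2 + q 3; m = (P + Q) / 8 in
     \<bar>p 0 - m\<bar> + \<bar>p 1 - m\<bar> + \<bar>p 2 - m\<bar> + \<bar>p 3 - m\<bar>
     + \<bar>q 0 - m\<bar> + \<bar>q 1 - m\<bar> + \<bar>q 2 - m\<bar> + \<bar>q 3 - m\<bar> + \<bar>P - Q\<bar>)"

text \<open>Row coefficients of the corners add up to 4, so the mean \<open>m\<close> becomes
  \<open>4 * m\<close> and the triangle inequality applies; column coefficients add up to 3. The two
  rows of central triangles contribute \<open>d\<close> and the new orientation surplus
  \<open>2 * d\<close>, which together are 3 times the old surplus.\<close>

lemma deviation_substitution:
  assumes "p' 0 = 3 * q 0 + q 1" "p' 1 = 2 * q 1 + 2 * q 2" "p' 2 = q 2 + 3 * q 3"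
    "p' 3 = p 0 + p 1 + p 2 + p 3" "q' 0 = q 0 + q 1 + q 2 + q 3"
    "q' 1 = 3 * p 0 + p 1" "q' 2 = 2 * p 1 + 2 * p 2" "q' 3 = p 2 + 3 * p 3"
  shows "deviation p' q' \<le> 3 * deviation p q"
proof -
  define P where "P = p 0 + p 1 + p 2 + p 3"
  define Q where "Q = q 0 + q 1 + q 2 + q 3"
  define m where "m = (P + Q) / 8"
  define P' where "P' = p' 0 + p' 1 + p' 2 + p' 3"
  define Q' where "Q' = q' 0 + q' 1 + q' 2 + q' 3"
  define a where "a x = \<bar>x - m\<bar>" for x
  define c where "c x = \<bar>x - 4 * m\<bar>" for x
  define d where "d = \<bar>P - Q\<bar>"
  have m': "(P' + Q') / 8 = 4 * m"
    by (simp add: P'_def Q'_def m_def P_def Q_def assms)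
  have "P' - Q' = - 2 * (P - Q)"
    by (simp add: P'_def Q'_def P_def Q_def assms)
  then have d': "\<bar>P' - Q'\<bar> = 2 * d"
    unfolding d_def by (simp only: abs_mult)
  have c31: "c (3 * x + y) \<le> 3 * a x + a y" for x y
    unfolding a_def c_def by (smt (verit))
  have c13: "c (x + 3 * y) \<le> a x + 3 * a y" for x y
    unfolding a_def c_def by (smt (verit))
  have c22: "c (2 * x + 2 * y) \<le> 2 * a x + 2 * a y" for x y
    unfolding a_def c_def by (smt (verit))
  have "P - 4 * m = (P - Q) / 2" "Q - 4 * m = - ((P - Q) / 2)"
    by (simp_all add: m_def field_simps)
  then have cPQ: "c P + c Q = d"
    unfolding c_def d_def by (simp only: abs_minus_cancel abs_divide)
  have "deviation p' q' = c (p' 0) + c (p' 1) + c (p' 2) + c (p' 3)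
      + c (q' 0) + c (q' 1) + c (q' 2) + c (q' 3) + 2 * d"
    unfolding deviation_def Let_def P'_def[symmetric] Q'_def[symmetric] m' d' c_def ..
  also have "\<dots> = c (3 * q 0 + q 1) + c (2 * q 1 + 2 * q 2) + c (q 2 + 3 * q 3)
      + c (3 * p 0 + p 1) + c (2 * p 1 + 2 * p 2) + c (p 2 + 3 * p 3) + (c P + c Q) + 2 * d"
    by (simp add: assms P_def Q_def)
  also have "\<dots> \<le> 3 * (a (p 0) + a (p 1) + a (p 2) + a (p 3) + a (q 0) + a (q 1) + a (q 2) + a (q 3) + d)"
    unfolding cPQ
    using c31[of "q 0" "q 1"] c31[of "p 0" "p 1"] c22[of "q 1" "q 2"] c22[of "p 1" "p 2"]
      c13[of "q 2" "q 3"] c13[of "p 2" "p 3"]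
    by (simp add: algebra_simps)
  also have "\<dots> = 3 * deviation p q"
    unfolding deviation_def Let_def P_def[symmetric] Q_def[symmetric] m_def[symmetric] a_def d_def ..
  finally show ?thesis .
qed

lemma deviation_commute: "deviation p q = deviation q p"
  by (simp add: deviation_def Let_def add_ac abs_minus_commute)

lemma discrepancy_eq_deviation:
  assumes "finite A"
  shows "discrepancy S A = deviation (type_count S A 1) (type_count S A (- 1))"
  unfolding discrepancy_def deviation_def Let_def sign_count_eq[OF assms, of _ S] by (simp add: add.assoc)

lemma discrepancy_children:
  assumes A: "A \<subseteq> tri_index" "finite A"
  shows "discrepancy S (children A) \<le> 3 * discrepancy (\<lambda>n. S (Suc n)) A"
proof -
  let ?S = "\<lambda>n. S (Suc n)"
  let ?p = "type_count ?S A 1" and ?q = "type_count ?S A (- 1)"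
  let ?p' = "type_count S (children A) 1" and ?q' = "type_count S (children A) (- 1)"
  note tc = type_count_children[OF A, of 1 S] type_count_children[OF A, of "- 1" S] sign_count_eq[OF A(2), of _ ?S]
  have "deviation ?p' ?q' \<le> 3 * deviation ?p ?q"
  proof (cases "crease_color (S 1) True = Red")
    case True
    then show ?thesis
      by (intro deviation_substitution) (simp_all add: tc crease_color_sign)
  next
    case False
    \<comment> \<open>A folding down gives the same substitution with the two orientations
      exchanged.\<close>
    then have "deviation ?q' ?p' \<le> 3 * deviation ?q ?p"
      by (intro deviation_substitution) (simp_all add: tc crease_color_sign)
    then show ?thesis
      by (simp only: deviation_commute)
  qed
  then show ?thesis
    by (simp add: discrepancy_eq_deviation A finite_children)
qed

lemma type_count_bounds:
  assumes "finite A"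
  shows "0 \<le> type_count S A s r" "type_count S A s r \<le> real (card A)"
proof -
  show "0 \<le> type_count S A s r"
    by (simp add: type_count_def sum_nonneg)
  have "type_count S A s r \<le> (\<Sum>t\<in>A. 1)"
    unfolding type_count_def by (intro sum_mono) simp
  then show "type_count S A s r \<le> real (card A)"
    by simp
qed

lemma discrepancy_eq_card:
  assumes "A \<subseteq> tri_index" "finite A"
  shows "discrepancy S A = (\<Sum>s\<in>{1,-1}. \<Sum>r\<in>{0,1,2,3}. \<bar>type_count S A s r - real (card A) / 8\<bar>)
     + \<bar>sign_count A 1 - sign_count A (- 1)\<bar>"
  unfolding discrepancy_def card_eq_sign_count[OF assms] ..

text \<open>Eight deviations and one orientation surplus, each at most the number of
  triangles.\<close>

lemma discrepancy_le_card:
  assumes A: "A \<subseteq> tri_index" "finite A"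
  shows "discrepancy S A \<le> 9 * real (card A)"
proof -
  have "\<bar>type_count S A s r - real (card A) / 8\<bar> \<le> real (card A)" for s r
    using type_count_bounds[OF A(2), of S s r] by linarith
  then have "(\<Sum>s\<in>{1,-1::real}. \<Sum>r\<in>{0,1,2,3}. \<bar>type_count S A s r - real (card A) / 8\<bar>)
      \<le> (\<Sum>s\<in>{1,-1::real}. \<Sum>r\<in>{0,1,2,3::nat}. real (card A))"
    by (intro sum_mono)
  moreover have "0 \<le> sign_count A s" for s
    by (simp add: sign_count_def sum_nonneg)
  then have "\<bar>sign_count A 1 - sign_count A (- 1)\<bar> \<le> real (card A)"
    unfolding card_eq_sign_count[OF A] by (smt (verit))
  ultimately show ?thesis
    unfolding discrepancy_eq_card[OF A] by simp
qed

text \<open>Counts and their mean are additive over disjoint unions, so each summand obeys the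
  triangle inequality. This lets the boundary triangles be treated separately.\<close>

lemma discrepancy_Un:
  assumes "finite A" "finite B" "A \<inter> B = {}"
  shows "discrepancy S (A \<union> B) \<le> discrepancy S A + discrepancy S B"
proof -
  have t: "type_count S (A \<union> B) s r = type_count S A s r + type_count S B s r" for s r
    unfolding type_count_def by (rule sum.union_disjoint[OF assms])
  have s: "sign_count (A \<union> B) s = sign_count A s + sign_count B s" for s
    unfolding sign_count_def by (rule sum.union_disjoint[OF assms])
  let ?f = "\<lambda>A s r. \<bar>type_count S A s r - (sign_count A 1 + sign_count A (- 1)) / 8\<bar>"
  have "?f (A \<union> B) s r \<le> ?f A s r + ?f B s r" for s r
  proof -
    have "type_count S (A \<union> B) s r - (sign_count (A \<union> B) 1 + sign_count (A \<union> B) (- 1)) / 8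
      = (type_count S A s r - (sign_count A 1 + sign_count A (- 1)) / 8) + (type_count S B s r - (sign_count B 1 + sign_count B (- 1)) / 8)"
      unfolding t s by (simp add: field_simps)
    then show ?thesis
      by (simp only: abs_triangle_ineq)
  qed
  then have "(\<Sum>s\<in>{1,-1}. \<Sum>r\<in>{0,1,2,3}. ?f (A \<union> B) s r) \<le> (\<Sum>s\<in>{1,-1}. \<Sum>r\<in>{0,1,2,3}. ?f A s r + ?f B s r)"
    by (intro sum_mono)
  moreover have "\<bar>sign_count (A \<union> B) 1 - sign_count (A \<union> B) (- 1)\<bar>
      \<le> \<bar>sign_count A 1 - sign_count A (- 1)\<bar> + \<bar>sign_count B 1 - sign_count B (- 1)\<bar>"
    unfolding s by linarith
  ultimately show ?thesis
    unfolding discrepancy_def sum.distrib by linarith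
qed

lemma discrepancy_recursion:
  assumes "0 \<le> R"
  shows "discrepancy S (tris_in R) \<le> 3 * discrepancy (\<lambda>n. S (Suc n)) (tris_in (R / 2)) + 8100 * (R + 1)"
proof -
  let ?A = "children (tris_in (R / 2))"
  have fin: "finite (tris_in R)" "finite (tris_in (R / 2))"
    using tris_in_finite_card[of R] tris_in_finite_card[of "R / 2"] assms by auto
  have sub: "tris_in r \<subseteq> tri_index" for r
    by (auto simp: tris_in_def)
  have "tris_in R = ?A \<union> (tris_in R - ?A)"
    using children_tris_in by blast
  then have "discrepancy S (tris_in R) \<le> discrepancy S ?A + discrepancy S (tris_in R - ?A)"
    using discrepancy_Un[of ?A "tris_in R - ?A" S] fin finite_children by auto
  also have "discrepancy S ?A \<le> 3 * discrepancy (\<lambda>n. S (Suc n)) (tris_in (R / 2))"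
    by (rule discrepancy_children[OF sub fin(2)])
  also have "discrepancy S (tris_in R - ?A) \<le> 9 * real (card (tris_in R - ?A))"
    using sub fin by (intro discrepancy_le_card) auto
  also have "\<dots> \<le> 9 * (900 * (R + 1))"
    using card_boundary[OF assms] by simp
  finally show ?thesis
    by simp
qed

text \<open>Each unrolling multiplies the quadratic term by 3 and halves the radius, hence the ratio
  3/4. The bound is uniform in \<open>S\<close> because the recursion shifts the sequence. For
  \<open>n = 0\<close> the constants come from \<open>9 * 25 * (R + 2)\<^sup>2\<close>.\<close>

lemma discrepancy_bound:
  "\<exists>C\<ge>0. \<forall>S R. 0 \<le> R \<longrightarrow> discrepancy S (tris_in R) \<le> 225 * (3 / 4) ^ n * R\<^sup>2 + C * (R + 1)"
proof (induction n)
  case 0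
  have "discrepancy S (tris_in R) \<le> 225 * R\<^sup>2 + 900 * (R + 1)" if R: "0 \<le> R" for S R
  proof -
    have "discrepancy S (tris_in R) \<le> 9 * real (card (tris_in R))"
      using tris_in_finite_card[OF R] by (intro discrepancy_le_card) (auto simp: tris_in_def)
    also have "\<dots> \<le> 9 * (25 * (R + 2)\<^sup>2)"
      using tris_in_finite_card[OF R] by simp
    finally show ?thesis
      by (simp add: power2_eq_square algebra_simps)
  qed
  then show ?case
    by (intro exI[of _ 900]) simp
next
  case (Suc n)
  then obtain C where C: "0 \<le> C" and
    IH: "\<And>S R. 0 \<le> R \<Longrightarrow> discrepancy S (tris_in R) \<le> 225 * (3 / 4) ^ n * R\<^sup>2 + C * (R + 1)"
    by blast
  have "discrepancy S (tris_in R) \<le> 225 * (3 / 4) ^ Suc n * R\<^sup>2 + (3 * C + 8100) * (R + 1)" if R: "0 \<le> R" for S R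
  proof -
    have "discrepancy S (tris_in R) \<le> 3 * discrepancy (\<lambda>n. S (Suc n)) (tris_in (R / 2)) + 8100 * (R + 1)"
      by (rule discrepancy_recursion[OF R])
    also have "discrepancy (\<lambda>n. S (Suc n)) (tris_in (R / 2)) \<le> 225 * (3 / 4) ^ n * (R / 2)\<^sup>2 + C * (R / 2 + 1)"
      using R by (intro IH) simp
    also have "C * (R / 2 + 1) \<le> C * (R + 1)"
      using C R by (intro mult_left_mono) auto
    finally show ?thesis
      by (simp add: power_divide algebra_simps)
  qed
  then show ?case
    using C by (intro exI[of _ "3 * C + 8100"]) simp
qed

section \<open>From counts to densities\<close>

definition orientation_sign :: "orientation \<Rightarrow> real" where
  "orientation_sign ori = (case ori of Positive \<Rightarrow> 1 | Negative \<Rightarrow> - 1)"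

lemma triangle_type_tri:
  assumes "t \<in> tri_index"
  shows "triangle_type S (tri t) = (ori, r) \<longleftrightarrow> snd t = orientation_sign ori \<and> red_count S t = r"
  using tri_index_sign[OF assms] unfolding triangle_type_def orientation_sign_def
  by (cases ori) (auto simp: orientation_tri[OF assms] red_sides_tri[OF assms])

lemma unit_triangles_in_ball_eq: "unit_triangles_in_ball R = tri ` tris_in R"
  unfolding unit_triangles_in_ball_def unit_triangles_eq tris_in_def tri_subset_ball[symmetric]
  by blast

lemma card_tri_image:
  assumes "A \<subseteq> tri_index"
  shows "card (tri ` A) = card A"
  by (rule card_image) (rule inj_on_subset[OF inj_on_tri assms])

lemma card_type_eq_type_count:
  assumes "0 \<le> R"
  shows "real (card {T \<in> unit_triangles_in_ball R. triangle_type S T = (ori, r)})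
    = type_count S (tris_in R) (orientation_sign ori) r"
proof -
  let ?A = "{t \<in> tris_in R. snd t = orientation_sign ori \<and> red_count S t = r}"
  have ind: "tris_in R \<subseteq> tri_index"
    by (auto simp: tris_in_def)
  have "{T \<in> unit_triangles_in_ball R. triangle_type S T = (ori, r)} = tri ` ?A"
    unfolding unit_triangles_in_ball_eq using triangle_type_tri[OF subsetD[OF ind]] by blast
  then have "card {T \<in> unit_triangles_in_ball R. triangle_type S T = (ori, r)} = card ?A"
    using card_tri_image[of ?A] ind by auto
  moreover have "real (card ?A) = type_count S (tris_in R) (orientation_sign ori) r"
    using tris_in_finite_card[OF assms] unfolding type_count_def of_bool_def
    by (simp add: sum.inter_filter[symmetric])
  ultimately show ?thesis
    by simp
qed

text \<open>A single deviation is at most the whole discrepancy, and the number of triangles is at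
  least \<open>R\<^sup>2 / 4\<close>.\<close>

lemma density_error:
  assumes R: "1 \<le> R" and r: "r \<in> {0,1,2,3}"
  shows "\<bar>real (card {T \<in> unit_triangles_in_ball R. triangle_type S T = (ori, r)}) /
      real (card (unit_triangles_in_ball R)) - 1 / 8\<bar> \<le> 4 * discrepancy S (tris_in R) / R\<^sup>2"
proof -
  let ?N = "real (card (tris_in R))" and ?c = "type_count S (tris_in R) (orientation_sign ori) r"
  have fin: "finite (tris_in R)" and ind: "tris_in R \<subseteq> tri_index"
    using tris_in_finite_card[of R] R by (auto simp: tris_in_def)
  have N: "R\<^sup>2 / 4 \<le> ?N"
    by (rule card_tris_in_ge[OF R])
  have R2: "0 < R\<^sup>2 / 4"
    using R by simp
  then have Npos: "0 < ?N"
    using N by linarith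
  define f where "f s r = \<bar>type_count S (tris_in R) s r - ?N / 8\<bar>" for s r
  define g where "g s = (\<Sum>r\<in>{0,1,2,3}. f s r)" for s
  have "0 \<le> f s r" for s r
    by (simp add: f_def)
  then have g: "0 \<le> g s" "f s r \<le> g s" for s
    unfolding g_def using r by (auto intro!: sum_nonneg member_le_sum)
  have "discrepancy S (tris_in R) = (\<Sum>s\<in>{1,-1}. g s) + \<bar>sign_count (tris_in R) 1 - sign_count (tris_in R) (- 1)\<bar>"
    unfolding discrepancy_eq_card[OF ind fin] f_def[symmetric] g_def[symmetric] ..
  then have "g 1 + g (- 1) \<le> discrepancy S (tris_in R)"
    by simp
  moreover have "orientation_sign ori = 1 \<or> orientation_sign ori = - 1"
    by (cases ori) (simp_all add: orientation_sign_def)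
  ultimately have "f (orientation_sign ori) r \<le> discrepancy S (tris_in R)"
    using g[of 1] g[of "- 1"] by auto
  then have le: "\<bar>?c - ?N / 8\<bar> \<le> discrepancy S (tris_in R)"
    by (simp only: f_def)
  have "?c / ?N - 1 / 8 = (?c - ?N / 8) / ?N"
    using Npos by (simp add: field_simps)
  then have "\<bar>?c / ?N - 1 / 8\<bar> = \<bar>?c - ?N / 8\<bar> / ?N"
    by (simp add: abs_divide)
  also have "\<dots> \<le> discrepancy S (tris_in R) / (R\<^sup>2 / 4)"
    using le N R2 by (intro frac_le) auto
  finally show ?thesis
    using card_type_eq_type_count[of R S ori r] card_tri_image[OF ind] R
    unfolding unit_triangles_in_ball_eq by (simp add: mult.commute)
qed

theorem theorem6p1:
  fixes S :: "nat \<Rightarrow> folding"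
  shows "\<forall>ori. \<forall>r\<in>{0, 1, 2, 3}. has_density S (ori, r) (1/8)"
proof (intro allI ballI)
  fix ori and r :: nat
  assume r: "r \<in> {0, 1, 2, 3}"
  let ?d = "\<lambda>R. real (card {T \<in> unit_triangles_in_ball R. triangle_type S T = (ori, r)}) /
      real (card (unit_triangles_in_ball R))"
  show "has_density S (ori, r) (1/8)"
    unfolding has_density_def
  proof (rule tendstoI)
    fix e :: real assume e: "0 < e"
    \<comment> \<open>The number of unrollings is fixed before \<open>R\<close> grows, since
      \<open>C\<close> depends on it; 1800 makes the quadratic part \<open>900 * (3 / 4) ^ n\<close>
      smaller than \<open>e / 2\<close>.\<close>
    obtain n where n: "(3 / 4 :: real) ^ n < e / 1800"
      using real_arch_pow_inv[of "e / 1800" "3 / 4"] e by auto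
    obtain C where C: "0 \<le> C" and
      bound: "\<And>S R. 0 \<le> R \<Longrightarrow> discrepancy S (tris_in R) \<le> 225 * (3 / 4) ^ n * R\<^sup>2 + C * (R + 1)"
      using discrepancy_bound[of n] by blast
    show "\<forall>\<^sub>F R in at_top. dist (?d R) (1 / 8) < e"
      \<comment> \<open>From \<open>R \<ge> 1\<close> follows \<open>R + 1 \<le> 2 * R\<close>, and
        the second threshold makes the boundary part \<open>8 * C / R\<close> at most
        \<open>e / 2\<close>.\<close>
      using eventually_ge_at_top[of "max 1 (16 * C / e)"]
    proof eventually_elim
      case (elim R)
      then have R: "1 \<le> R" and CR: "16 * C / e \<le> R"
        by auto
      have "\<bar>?d R - 1 / 8\<bar> \<le> 4 * discrepancy S (tris_in R) / R\<^sup>2"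
        by (rule density_error[OF R r])
      also have "\<dots> \<le> 4 * (225 * (3 / 4) ^ n * R\<^sup>2 + C * (2 * R)) / R\<^sup>2"
      proof -
        have "C * (R + 1) \<le> C * (2 * R)"
          using C R by (intro mult_left_mono) auto
        then have "discrepancy S (tris_in R) \<le> 225 * (3 / 4) ^ n * R\<^sup>2 + C * (2 * R)"
          using bound[of R S] R by linarith
        then show ?thesis
          by (intro divide_right_mono) auto
      qed
      also have "\<dots> = 900 * (3 / 4) ^ n + 8 * C / R"
        using R by (simp add: field_simps power2_eq_square)
      also have "\<dots> < e / 2 + e / 2"
      proof (rule add_less_le_mono)
        show "900 * (3 / 4) ^ n < e / 2"
          using n by simp
        show "8 * C / R \<le> e / 2"
          using CR R e by (simp add: field_simps)
      qed
      finally show ?case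
        by (simp add: dist_real_def)
    qed
  qed
qed

end
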